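(* Let $L$ be a $\kappa$-frame. The lattice $\mathfrak{C}L$ of those congruences on $L$ that have fewer than $\kappa$ generators is a zero-dimensional $\kappa$-frame, and the map $\nabla_\bullet: L\to\mathfrak{C}L$, $a\mapsto\nabla_a$, is an injective $\kappa$-frame homomorphism. Furthermore, if $C\in\mathfrak{C}L$, then $\mathfrak{C}(L/C)$ is canonically isomorphic to $\mathfrak{C}L/\widetilde\nabla_C$.
   Context: Here $\kappa$ is either an infinite regular cardinal or the symbol $\infty$. A $\kappa$-set is a set of cardinality less than $\kappa$ (any set if $\kappa=\infty$). A $\kappa$-frame is a bounded distributive lattice with joins of all $\kappa$-sets, over which binary meets distribute; for $\kappa=\infty$ this is a frame. Homomorphisms preserve finite meets and $\kappa$-joins (joins of $\kappa$-sets). A congruence on $L$ is an equivalence relation on $L$ closed under finite meets and $\kappa$-joins in $L\times L$; congruences are ordered by inclusion and form a lattice $\mathbb{C}L$. $\mathfrak{C}L$ consists of the congruences generated by a $\kappa$-set of pairs (for $\kappa=\infty$, $\mathfrak{C}L=\mathbb{C}L$). For $a\in L$, $\nabla_a$ is the congruence generated by $(0,a)$. A $\kappa$-frame is zero-dimensional if every element is a $\kappa$-join of complemented elements. For a congruence $C$ on $L$, $\widetilde\nabla_C$ denotes the congruence on the $\kappa$-frame $\mathfrak{C}L$ generated by $\{(\nabla_a,\nabla_b)\mid (a,b)\in C\}$ (equivalently, the join of the congruences on $\mathfrak{C}L$ generated by $(0,A)$ for $A\in\mathfrak{C}L$, $A\le C$). The canonical isomorphism is the one under which $\nabla_{[a]}\in\mathfrak{C}(L/C)$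 corresponds to the class of $\nabla_a$ in $\mathfrak{C}L/\widetilde\nabla_C$, for $a \in L$. *)

theory Defs
  imports "HOL-Algebra.Lattice"
begin

unbundle cardinal_syntax

text \<open>
  The bound is either an infinite regular cardinal, \<open>Some r\<close>, in the library's representation of
  cardinals by well-order relations, or the symbol infinity, \<open>None\<close>.
\<close>

definition admissible :: "'k rel option \<Rightarrow> bool" where
  "admissible \<kappa> \<longleftrightarrow>
     (case \<kappa> of None \<Rightarrow> True | Some r \<Rightarrow> Card_order r \<and> infinite (Field r) \<and> regularCard r)"

definition kset :: "'k rel option \<Rightarrow> 'a set \<Rightarrow> bool" where
  "kset \<kappa> A \<longleftrightarrow> (case \<kappa> of None \<Rightarrow> True | Some r \<Rightarrow> |A| <o r)"

text \<open>
  The carrier-based orders of HOL-Algebra are used throughout, because congruence lattices and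
  quotients occur as objects; all operations are those determined by the order. The locale
  \<open>bounded_lattice\<close> forces the \<open>eq\<close> field to be equality.
\<close>

locale kframe = bounded_lattice L for \<kappa> :: "'k rel option" and L (structure) +
  assumes distrib:
      "\<lbrakk>x \<in> carrier L; y \<in> carrier L; z \<in> carrier L\<rbrakk> \<Longrightarrow> x \<sqinter> (y \<squnion> z) = (x \<sqinter> y) \<squnion> (x \<sqinter> z)"
    and ksup_exists:
      "\<lbrakk>A \<subseteq> carrier L; kset \<kappa> A\<rbrakk> \<Longrightarrow> \<exists>s. least L s (Upper L A)"
    and meet_ksup_distrib:
      "\<lbrakk>x \<in> carrier L; A \<subseteq> carrier L; kset \<kappa> A\<rbrakk> \<Longrightarrow> x \<sqinter> \<Squnion>A = \<Squnion>((\<lambda>a. x \<sqinter> a) ` A)"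

definition complemented :: "('a, 'm) gorder_scheme \<Rightarrow> 'a \<Rightarrow> bool" where
  "complemented L a \<longleftrightarrow>
     a \<in> carrier L \<and>
     (\<exists>b\<in>carrier L. a \<sqinter>\<^bsub>L\<^esub> b = \<bottom>\<^bsub>L\<^esub> \<and> a \<squnion>\<^bsub>L\<^esub> b = \<top>\<^bsub>L\<^esub>)"

definition zero_dimensional :: "'k rel option \<Rightarrow> ('a, 'm) gorder_scheme \<Rightarrow> bool" where
  "zero_dimensional \<kappa> L \<longleftrightarrow>
     (\<forall>a\<in>carrier L. \<exists>S. S \<subseteq> {c. complemented L c} \<and> kset \<kappa> S \<and> a = \<Squnion>\<^bsub>L\<^esub>S)"

text \<open>Finite meets and \<open>\<kappa>\<close>-joins include the empty ones, that is, top and bottom.\<close>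

definition kframe_hom ::
    "'k rel option \<Rightarrow> ('a, 'm) gorder_scheme \<Rightarrow> ('b, 'n) gorder_scheme \<Rightarrow> ('a \<Rightarrow> 'b) \<Rightarrow> bool" where
  "kframe_hom \<kappa> L M f \<longleftrightarrow>
     kframe \<kappa> L \<and> kframe \<kappa> M \<and> f \<in> carrier L \<rightarrow> carrier M \<and>
     (\<forall>A. A \<subseteq> carrier L \<longrightarrow> finite A \<longrightarrow> f (\<Sqinter>\<^bsub>L\<^esub>A) = \<Sqinter>\<^bsub>M\<^esub>(f ` A)) \<and>
     (\<forall>A. A \<subseteq> carrier L \<longrightarrow> kset \<kappa> A \<longrightarrow> f (\<Squnion>\<^bsub>L\<^esub>A) = \<Squnion>\<^bsub>M\<^esub>(f ` A))"

definition kframe_iso ::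
    "'k rel option \<Rightarrow> ('a, 'm) gorder_scheme \<Rightarrow> ('b, 'n) gorder_scheme \<Rightarrow> ('a \<Rightarrow> 'b) \<Rightarrow> bool" where
  "kframe_iso \<kappa> L M f \<longleftrightarrow> kframe_hom \<kappa> L M f \<and> bij_betw f (carrier L) (carrier M)"

text \<open>Meets and joins in \<open>L \<times> L\<close> are computed componentwise.\<close>

definition congruence :: "'k rel option \<Rightarrow> ('a, 'm) gorder_scheme \<Rightarrow> 'a rel \<Rightarrow> bool" where
  "congruence \<kappa> L C \<longleftrightarrow>
     equiv (carrier L) C \<and>
     (\<forall>S. S \<subseteq> C \<longrightarrow> finite S \<longrightarrow> (\<Sqinter>\<^bsub>L\<^esub>(fst ` S), \<Sqinter>\<^bsub>L\<^esub>(snd ` S)) \<in> C) \<and>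
     (\<forall>S. S \<subseteq> C \<longrightarrow> kset \<kappa> S \<longrightarrow> (\<Squnion>\<^bsub>L\<^esub>(fst ` S), \<Squnion>\<^bsub>L\<^esub>(snd ` S)) \<in> C)"

definition cgen :: "'k rel option \<Rightarrow> ('a, 'm) gorder_scheme \<Rightarrow> 'a rel \<Rightarrow> 'a rel" where
  "cgen \<kappa> L R = \<Inter>{C. congruence \<kappa> L C \<and> R \<subseteq> C}"

definition kcong_lattice :: "'k rel option \<Rightarrow> ('a, 'm) gorder_scheme \<Rightarrow> 'a rel gorder" where
  "kcong_lattice \<kappa> L =
     \<lparr>carrier = {cgen \<kappa> L R | R. R \<subseteq> carrier L \<times> carrier L \<and> kset \<kappa> R},
      eq = (=), le = (\<subseteq>)\<rparr>"

definition nabla :: "'k rel option \<Rightarrow> ('a, 'm) gorder_scheme \<Rightarrow> 'a \<Rightarrow> 'a rel" where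
  "nabla \<kappa> L a = cgen \<kappa> L {(\<bottom>\<^bsub>L\<^esub>, a)}"

text \<open>
  The order of the quotient lattice: \<open>[a]\<close> is below \<open>[b]\<close> iff \<open>[a \<sqinter> b] = [a]\<close>.
\<close>

definition quot :: "('a, 'm) gorder_scheme \<Rightarrow> 'a rel \<Rightarrow> 'a set gorder" where
  "quot L C =
     \<lparr>carrier = carrier L // C, eq = (=),
      le = (\<lambda>X Y. \<exists>a\<in>X. \<exists>b\<in>Y. C `` {a \<sqinter>\<^bsub>L\<^esub> b} = X)\<rparr>"

definition nabla_tilde ::
    "'k rel option \<Rightarrow> ('a, 'm) gorder_scheme \<Rightarrow> 'a rel \<Rightarrow> 'a rel rel" where
  "nabla_tilde \<kappa> L C =
     cgen \<kappa> (kcong_lattice \<kappa> L) {(nabla \<kappa> L a, nabla \<kappa> L b) | a b. (a, b) \<in> C}"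

text \<open>
  The values of the isomorphism are prescribed only at the \<open>\<nabla>\<^bsub>[a]\<^esub>\<close>; \<open>extensional\<close> removes the
  freedom in its values outside the carrier, so that it can be asserted to be unique.
\<close>

definition canonical_iso ::
    "'k rel option \<Rightarrow> ('a, 'm) gorder_scheme \<Rightarrow> 'a rel \<Rightarrow> ('a set rel \<Rightarrow> 'a rel set) \<Rightarrow> bool" where
  "canonical_iso \<kappa> L C \<phi> \<longleftrightarrow>
     \<phi> \<in> extensional (carrier (kcong_lattice \<kappa> (quot L C))) \<and>
     kframe_iso \<kappa> (kcong_lattice \<kappa> (quot L C))
       (quot (kcong_lattice \<kappa> L) (nabla_tilde \<kappa> L C)) \<phi> \<and>
     (\<forall>a\<in>carrier L.
        \<phi> (nabla \<kappa> (quot L C) (C `` {a})) = nabla_tilde \<kappa> L C `` {nabla \<kappa> L a})"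

end

theory Submission
  imports Defs
begin

text \<open>
  Everything rests on the maps \<open>clamp c d x = (x \<sqinter> d) \<squnion> c\<close>, for \<open>c \<sqsubseteq> d\<close> the retraction of \<open>L\<close>
  onto an interval.
  They preserve binary meets and nonempty \<open>\<kappa>\<close>-joins, so the inverse image of a congruence under a
  clamp is again a congruence. No description of the elements of a generated congruence is needed:
  to bound \<open>cgen \<kappa> L R\<close> it is enough to find a congruence, usually such an inverse image, above \<open>R\<close>.

  Frame laws. For congruences \<open>C\<close> and \<open>D\<close>, the pairs \<open>(x, y)\<close> whose images under \<open>clamp c d\<close> are
  \<open>D\<close>-related for all \<open>c \<sqsubseteq> d\<close> with \<open>(c, d) \<in> C\<close> form a congruence, and it is the Heyting implication
  \<open>C \<rightarrow> D\<close> (\<open>Int_cgen_subset\<close>). Hence intersection distributes over joins. The same maps give explicit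
  generators for an intersection of generated congruences (\<open>cgen_Int\<close>): the pairs
  \<open>(clamp x y c, clamp x y d)\<close> for generators \<open>(x, y)\<close> of one, with \<open>x \<sqsubseteq> y\<close>, and \<open>(c, d)\<close> of the other.
  So the \<open>\<kappa>\<close>-generated congruences are closed under binary meets, and regularity of \<open>\<kappa>\<close> gives
  closure under \<open>\<kappa>\<close>-joins.

  Zero-dimensionality. A congruence is the join of the principal congruences of its generators
  \<open>(c, d)\<close>, which may be taken with \<open>c \<sqsubseteq> d\<close>; the formula for intersections shows that the congruence
  generated by \<open>(\<bottom>, c)\<close> and \<open>(d, \<top>)\<close> is a complement of such a principal congruence.

  The embedding. The congruence \<open>\<nabla>\<^sub>b\<close> consists of the pairs with \<open>x \<squnion> b = y \<squnion> b\<close>, the kernel of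
  \<open>clamp b \<top>\<close> (\<open>nabla_iff\<close>), so \<open>\<nabla>\<^sub>a \<subseteq> \<nabla>\<^sub>b\<close> exactly if \<open>a \<sqsubseteq> b\<close>.

  The isomorphism. Write \<open>K\<close> for the \<open>\<kappa>\<close>-frame of \<open>\<kappa>\<close>-generated congruences on \<open>L\<close>. If \<open>C\<close> lies in \<open>K\<close>,
  then the congruence \<open>nabla_tilde \<kappa> L C\<close> on \<open>K\<close> is just \<open>\<nabla>\<^sub>C\<close> formed in \<open>K\<close> (\<open>nabla_tilde_eq\<close>): it relates
  \<open>A\<close> and \<open>B\<close> if their joins with \<open>C\<close> agree. Every class thus contains exactly one congruence above
  \<open>C\<close>, and the congruences above \<open>C\<close> are the inverse images of those on \<open>L / C\<close>, with matching
  generators (\<open>pull_cgen\<close>). This is an order isomorphism, and order isomorphisms preserve all joins and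
  meets. It is unique because a homomorphism out of a \<open>\<kappa>\<close>-frame of congruences is determined by the
  values at the \<open>\<nabla>\<^sub>a\<close>: it preserves complements, and joins of meets of the \<open>\<nabla>\<^sub>d\<close> with complements of the
  \<open>\<nabla>\<^sub>c\<close> are everything (\<open>kcong_hom_eqI\<close>).
\<close>

section \<open>Cardinality bounds\<close>

lemma kset_mono: "kset \<kappa> A \<Longrightarrow> B \<subseteq> A \<Longrightarrow> kset \<kappa> B"
  unfolding kset_def by (auto split: option.splits intro: ordLeq_ordLess_trans[OF card_of_mono1])

lemma kset_image: "kset \<kappa> A \<Longrightarrow> kset \<kappa> (f ` A)"
  unfolding kset_def by (auto split: option.splits intro: ordLeq_ordLess_trans[OF card_of_image])

lemma kset_finite:
  assumes "admissible \<kappa>" "finite A" shows "kset \<kappa> A"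
proof (cases \<kappa>)
  case (Some r)
  then have "Card_order r" "infinite (Field r)" using assms by (auto simp: admissible_def)
  then show ?thesis unfolding kset_def Some
    by (auto intro!: finite_ordLess_infinite card_of_Well_order card_order_on_well_order_on
        simp: assms(2) Field_card_of)
qed (simp add: kset_def)

text \<open>This is where regularity of the cardinal is needed.\<close>

lemma kset_UN:
  assumes "admissible \<kappa>" "kset \<kappa> I" "\<And>i. i \<in> I \<Longrightarrow> kset \<kappa> (A i)"
  shows "kset \<kappa> (\<Union>i\<in>I. A i)"
proof (cases \<kappa>)
  case (Some r)
  then have "stable r" using assms(1) by (auto simp: admissible_def intro: regularCard_stable)
  then show ?thesis using assms(2,3) unfolding kset_def Some by (auto intro: stable_UNION)
qed (simp add: kset_def)

lemma kset_Times:
  assumes "admissible \<kappa>" "kset \<kappa> A" "kset \<kappa> B" shows "kset \<kappa> (A \<times> B)"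
proof -
  have "kset \<kappa> (\<Union>a\<in>A. Pair a ` B)"
    using assms by (intro kset_UN) (auto intro: kset_image)
  then show ?thesis by (rule kset_mono) auto
qed

text \<open>
  Choosing one preimage per element keeps the cardinality; in this way \<open>\<kappa>\<close>-sets of congruence classes,
  or of pairs of them, are traded for \<open>\<kappa>\<close>-sets of representatives.
\<close>

lemma kset_lift:
  assumes "F \<subseteq> f ` X" "kset \<kappa> F"
  obtains A where "A \<subseteq> X" "kset \<kappa> A" "F = f ` A"
proof
  show "inv_into X f ` F \<subseteq> X" using assms(1) by (auto intro: inv_into_into)
  show "kset \<kappa> (inv_into X f ` F)" using assms(2) by (rule kset_image)
  show "F = f ` (inv_into X f ` F)" using image_inv_into_cancel[OF refl assms(1)] by simp
qed


section \<open>Order theory of \<open>\<kappa>\<close>-frames\<close>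

context partial_order
begin

lemma Sup_eqI:
  assumes "least L s (Upper L A)" shows "\<Squnion>A = s"
  unfolding Lattice.sup_def using assms by (metis least_unique someI)

lemma Inf_eqI:
  assumes "greatest L s (Lower L A)" shows "\<Sqinter>A = s"
  unfolding Lattice.inf_def using assms by (metis greatest_unique someI)

end

locale admissible_kframe = kframe \<kappa> L for \<kappa> :: "'k rel option" and L (structure) +
  assumes adm: "admissible \<kappa>"
begin

text \<open>
  These rules chain \<open>.=\<close>, \<open>\<sqsubseteq>\<close> and membership without bound, so they make classical search diverge.
\<close>

declare le_cong_l [rule del] le_cong_r [rule del] weak_le_antisym [rule del]
  le_antisym [rule del] least_closed [rule del] greatest_closed [rule del]
  Upper_memD [rule del] Lower_memD [rule del] Upper_elemD [rule del]

lemma ksup_least: "A \<subseteq> carrier L \<Longrightarrow> kset \<kappa> A \<Longrightarrow> least L (\<Squnion>A) (Upper L A)"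
  using ksup_exists Sup_eqI by metis

lemma ksup_closed: "A \<subseteq> carrier L \<Longrightarrow> kset \<kappa> A \<Longrightarrow> \<Squnion>A \<in> carrier L"
  using ksup_least by (meson least_closed Upper_closed)

lemma ksup_upper: "A \<subseteq> carrier L \<Longrightarrow> kset \<kappa> A \<Longrightarrow> a \<in> A \<Longrightarrow> a \<sqsubseteq> \<Squnion>A"
  using ksup_least by (metis least_Upper_above)

lemma ksup_le:
  "A \<subseteq> carrier L \<Longrightarrow> kset \<kappa> A \<Longrightarrow> u \<in> carrier L \<Longrightarrow> (\<And>a. a \<in> A \<Longrightarrow> a \<sqsubseteq> u) \<Longrightarrow> \<Squnion>A \<sqsubseteq> u"
  using ksup_least by (metis least_le Upper_memI)

lemma sup_eqI:
  assumes "A \<subseteq> carrier L" "s \<in> carrier L" "\<And>a. a \<in> A \<Longrightarrow> a \<sqsubseteq> s"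
    "\<And>u. u \<in> carrier L \<Longrightarrow> (\<And>a. a \<in> A \<Longrightarrow> a \<sqsubseteq> u) \<Longrightarrow> s \<sqsubseteq> u"
  shows "\<Squnion>A = s"
  using assms(1-3) by (intro Sup_eqI least_UpperI) (auto simp: Upper_def intro!: assms(4))

lemma inf_eqI:
  assumes "A \<subseteq> carrier L" "s \<in> carrier L" "\<And>a. a \<in> A \<Longrightarrow> s \<sqsubseteq> a"
    "\<And>u. u \<in> carrier L \<Longrightarrow> (\<And>a. a \<in> A \<Longrightarrow> u \<sqsubseteq> a) \<Longrightarrow> u \<sqsubseteq> s"
  shows "\<Sqinter>A = s"
  using assms(1-3) by (intro Inf_eqI greatest_LowerI) (auto simp: Lower_def intro!: assms(4))

lemma sup_empty: "\<Squnion>{} = \<bottom>"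
  by (rule sup_eqI) auto

lemma inf_empty: "\<Sqinter>{} = \<top>"
  by (rule inf_eqI) auto

lemma finite_inf_greatest:
  "finite A \<Longrightarrow> A \<subseteq> carrier L \<Longrightarrow> greatest L (\<Sqinter>A) (Lower L A)"
  using finite_inf_greatest by (cases "A = {}") (auto simp: inf_empty intro!: top_greatest)

lemma finite_inf_closed: "finite A \<Longrightarrow> A \<subseteq> carrier L \<Longrightarrow> \<Sqinter>A \<in> carrier L"
  using finite_inf_greatest by (meson greatest_closed Lower_closed)

lemma finite_inf_lower: "finite A \<Longrightarrow> A \<subseteq> carrier L \<Longrightarrow> a \<in> A \<Longrightarrow> \<Sqinter>A \<sqsubseteq> a"
  using finite_inf_greatest by (metis greatest_Lower_below)

lemma le_finite_inf:
  "finite A \<Longrightarrow> A \<subseteq> carrier L \<Longrightarrow> u \<in> carrier L \<Longrightarrow> (\<And>a. a \<in> A \<Longrightarrow> u \<sqsubseteq> a) \<Longrightarrow> u \<sqsubseteq> \<Sqinter>A"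
  using finite_inf_greatest by (metis greatest_le Lower_memI)

lemma inf_insert:
  assumes "finite A" "A \<subseteq> carrier L" "x \<in> carrier L"
  shows "\<Sqinter>(insert x A) = x \<sqinter> \<Sqinter>A"
proof (rule inf_eqI)
  note c = finite_inf_closed[OF assms(1,2)]
  show "insert x A \<subseteq> carrier L" "x \<sqinter> \<Sqinter>A \<in> carrier L" using assms c by simp_all
  fix a assume "a \<in> insert x A"
  then consider "a = x" | "a \<in> A" by (meson insertE)
  then show "x \<sqinter> \<Sqinter>A \<sqsubseteq> a"
  proof cases
    case 2
    then show ?thesis using assms c
      by (meson finite_inf_lower le_trans meet_closed meet_right subsetD)
  qed (use assms c in \<open>simp add: meet_left\<close>)
next
  note c = finite_inf_closed[OF assms(1,2)]
  fix u assume "u \<in> carrier L" "\<And>a. a \<in> insert x A \<Longrightarrow> u \<sqsubseteq> a"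
  then show "u \<sqsubseteq> x \<sqinter> \<Sqinter>A"
    using assms c by (intro meet_le le_finite_inf) auto
qed

lemma meet_absorb: "x \<in> carrier L \<Longrightarrow> y \<in> carrier L \<Longrightarrow> x \<sqsubseteq> y \<Longrightarrow> x \<sqinter> y = x"
  using le_iff_join by metis

lemma join_absorb: "x \<in> carrier L \<Longrightarrow> y \<in> carrier L \<Longrightarrow> x \<sqsubseteq> y \<Longrightarrow> x \<squnion> y = y"
  using le_iff_meet by metis

lemma meet_assoc:
  "x \<in> carrier L \<Longrightarrow> y \<in> carrier L \<Longrightarrow> z \<in> carrier L \<Longrightarrow> (x \<sqinter> y) \<sqinter> z = x \<sqinter> (y \<sqinter> z)"
  using weak_meet_assoc by (simp add: eq_is_equal)

lemma join_assoc:
  "x \<in> carrier L \<Longrightarrow> y \<in> carrier L \<Longrightarrow> z \<in> carrier L \<Longrightarrow> (x \<squnion> y) \<squnion> z = x \<squnion> (y \<squnion> z)"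
  using weak_join_assoc by (simp add: eq_is_equal)

lemma meet_idem: "x \<in> carrier L \<Longrightarrow> x \<sqinter> x = x"
  by (simp add: meet_absorb)

lemma join_idem: "x \<in> carrier L \<Longrightarrow> x \<squnion> x = x"
  by (simp add: join_absorb)

lemma distrib_right:
  "x \<in> carrier L \<Longrightarrow> y \<in> carrier L \<Longrightarrow> z \<in> carrier L \<Longrightarrow> (y \<squnion> z) \<sqinter> x = (y \<sqinter> x) \<squnion> (z \<sqinter> x)"
  by (metis distrib meet_comm)

lemma join_meet_absorb: "x \<in> carrier L \<Longrightarrow> y \<in> carrier L \<Longrightarrow> (y \<sqinter> x) \<squnion> x = x"
  by (simp add: join_absorb meet_right)

lemma meet_join_absorb: "x \<in> carrier L \<Longrightarrow> y \<in> carrier L \<Longrightarrow> x \<sqinter> (y \<squnion> x) = x"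
  by (simp add: meet_absorb join_right)

lemma dual_distrib:
  assumes "x \<in> carrier L" "y \<in> carrier L" "z \<in> carrier L"
  shows "(x \<sqinter> y) \<squnion> z = (x \<squnion> z) \<sqinter> (y \<squnion> z)"
proof -
  have "(x \<squnion> z) \<sqinter> (y \<squnion> z) = (x \<squnion> z) \<sqinter> y \<squnion> (x \<squnion> z) \<sqinter> z"
    using assms by (simp add: distrib)
  also have "(x \<squnion> z) \<sqinter> z = z"
    using assms meet_join_absorb meet_comm by metis
  also have "(x \<squnion> z) \<sqinter> y = x \<sqinter> y \<squnion> z \<sqinter> y"
    using assms by (simp add: distrib_right)
  also have "x \<sqinter> y \<squnion> z \<sqinter> y \<squnion> z = x \<sqinter> y \<squnion> (z \<sqinter> y \<squnion> z)"
    using assms by (simp add: join_assoc)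
  also have "z \<sqinter> y \<squnion> z = z"
    using assms join_meet_absorb meet_comm by metis
  finally show ?thesis by simp
qed

text \<open>
  For \<open>c \<sqsubseteq> d\<close>, the retraction of \<open>L\<close> onto the interval from \<open>c\<close> to \<open>d\<close>.
\<close>

definition clamp :: "_ \<Rightarrow> _ \<Rightarrow> _ \<Rightarrow> _" where
  "clamp c d x = (x \<sqinter> d) \<squnion> c"

lemma clamp_closed [simp]:
  "c \<in> carrier L \<Longrightarrow> d \<in> carrier L \<Longrightarrow> x \<in> carrier L \<Longrightarrow> clamp c d x \<in> carrier L"
  by (simp add: clamp_def)

lemma clamp_meet:
  assumes "c \<in> carrier L" "d \<in> carrier L" "x \<in> carrier L" "y \<in> carrier L"
  shows "clamp c d (x \<sqinter> y) = clamp c d x \<sqinter> clamp c d y"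
proof -
  have "x \<sqinter> y \<sqinter> d = (x \<sqinter> d) \<sqinter> (y \<sqinter> d)"
    using assms by (metis meet_assoc meet_closed meet_comm meet_idem)
  then show ?thesis using assms by (simp add: clamp_def dual_distrib)
qed

text \<open>
  Nonemptiness is essential: the empty join is \<open>\<bottom>\<close>, which \<open>clamp c d\<close> sends to \<open>c\<close>.
\<close>

lemma clamp_ksup:
  assumes c: "c \<in> carrier L" "d \<in> carrier L" and A: "A \<subseteq> carrier L" "kset \<kappa> A" "A \<noteq> {}"
  shows "clamp c d (\<Squnion>A) = \<Squnion>(clamp c d ` A)"
proof (rule sup_eqI[symmetric])
  have B: "(\<lambda>a. d \<sqinter> a) ` A \<subseteq> carrier L" "kset \<kappa> ((\<lambda>a. d \<sqinter> a) ` A)"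
    using A c by (auto intro: kset_image)
  have eq: "clamp c d (\<Squnion>A) = \<Squnion>((\<lambda>a. d \<sqinter> a) ` A) \<squnion> c"
    using A c by (simp add: clamp_def meet_ksup_distrib[symmetric] meet_comm[where y=d])
  show "clamp c d ` A \<subseteq> carrier L" "clamp c d (\<Squnion>A) \<in> carrier L"
    using A c by (auto simp: ksup_closed)
  show "a \<sqsubseteq> clamp c d (\<Squnion>A)" if "a \<in> clamp c d ` A" for a
  proof -
    from that obtain b where b: "b \<in> A" "a = (d \<sqinter> b) \<squnion> c"
      by (auto simp: clamp_def meet_comm[where y=d])
    then have "d \<sqinter> b \<sqsubseteq> \<Squnion>((\<lambda>a. d \<sqinter> a) ` A)" using B by (intro ksup_upper) auto
    moreover have "d \<sqinter> b \<in> carrier L" using b A c by auto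
    ultimately show ?thesis unfolding eq b(2) using c ksup_closed[OF B]
      by (meson join_closed join_le join_left join_right le_trans)
  qed
  show "clamp c d (\<Squnion>A) \<sqsubseteq> u" if u: "u \<in> carrier L" "\<And>a. a \<in> clamp c d ` A \<Longrightarrow> a \<sqsubseteq> u" for u
  proof -
    have le: "d \<sqinter> b \<sqsubseteq> u" "c \<sqsubseteq> u" if "b \<in> A" for b
    proof -
      have "(d \<sqinter> b) \<squnion> c \<sqsubseteq> u" using u that by (auto simp: clamp_def meet_comm[where y=d])
      moreover have "d \<sqinter> b \<in> carrier L" using that A c by auto
      ultimately show "d \<sqinter> b \<sqsubseteq> u" "c \<sqsubseteq> u" using c u(1)
        by (meson join_closed join_left join_right le_trans)+
    qed
    then have "\<Squnion>((\<lambda>a. d \<sqinter> a) ` A) \<sqsubseteq> u" using B u by (intro ksup_le) auto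
    then show ?thesis unfolding eq using le A(3) c u ksup_closed[OF B] by (auto intro!: join_le)
  qed
qed

text \<open>
  The next two lemmas exchange the roles of two intervals: truncating the ends of the interval
  \<open>[c, d]\<close> to \<open>[x, y]\<close>, and then truncating back to \<open>[c, d]\<close>, gives the truncations of \<open>x\<close> and \<open>y\<close>.
\<close>

lemma clamp_clamp_lower:
  assumes "c \<in> carrier L" "d \<in> carrier L" "x \<in> carrier L" "y \<in> carrier L" "c \<sqsubseteq> d"
  shows "clamp c d (clamp x y c) = clamp c d x"
proof -
  have "(c \<sqinter> y \<squnion> x) \<sqinter> d = (c \<sqinter> y) \<sqinter> d \<squnion> (x \<sqinter> d)"
    using assms by (simp add: distrib_right)
  also have "(c \<sqinter> y) \<sqinter> d = c \<sqinter> y"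
    using assms by (meson le_trans meet_absorb meet_closed meet_left)
  finally have "clamp c d (clamp x y c) = (x \<sqinter> d) \<squnion> (c \<sqinter> y) \<squnion> c"
    by (simp add: clamp_def join_comm)
  also have "\<dots> = (x \<sqinter> d) \<squnion> ((c \<sqinter> y) \<squnion> c)"
    using assms by (simp add: join_assoc)
  also have "(c \<sqinter> y) \<squnion> c = c"
    using assms by (simp add: join_absorb meet_left)
  finally show ?thesis by (simp add: clamp_def)
qed

lemma clamp_clamp_upper:
  assumes "c \<in> carrier L" "d \<in> carrier L" "x \<in> carrier L" "y \<in> carrier L" "x \<sqsubseteq> y"
  shows "clamp c d (clamp x y d) = clamp c d y"
proof -
  have "(d \<sqinter> y \<squnion> x) \<sqinter> d = (d \<sqinter> y) \<sqinter> d \<squnion> (x \<sqinter> d)"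
    using assms by (simp add: distrib_right)
  also have "(d \<sqinter> y) \<sqinter> d = y \<sqinter> d"
    using assms by (metis meet_absorb meet_closed meet_comm meet_left)
  also have "(y \<sqinter> d) \<squnion> (x \<sqinter> d) = (y \<squnion> x) \<sqinter> d"
    using assms by (simp add: distrib_right)
  also have "y \<squnion> x = y"
    using assms join_absorb join_comm by metis
  finally show ?thesis by (simp add: clamp_def)
qed


section \<open>Congruences\<close>

text \<open>
  Reflexivity at \<open>\<bottom>\<close> and \<open>\<top>\<close> takes care of the empty join and the empty meet, so maps that do not
  preserve the bounds, such as \<open>clamp\<close>, can still be used to build congruences.
\<close>

lemma congruenceI:
  assumes eq: "equiv (carrier L) C"
    and meet: "\<And>a b c d. (a, b) \<in> C \<Longrightarrow> (c, d) \<in> C \<Longrightarrow> (a \<sqinter> c, b \<sqinter> d) \<in> C"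
    and ksup: "\<And>S. S \<subseteq> C \<Longrightarrow> kset \<kappa> S \<Longrightarrow> S \<noteq> {} \<Longrightarrow> (\<Squnion>(fst ` S), \<Squnion>(snd ` S)) \<in> C"
  shows "congruence \<kappa> L C"
  unfolding congruence_def
proof (intro conjI allI impI)
  have C: "C \<subseteq> carrier L \<times> carrier L" using eq by (metis equivE)
  show "equiv (carrier L) C" by fact
  show "(\<Sqinter>(fst ` S), \<Sqinter>(snd ` S)) \<in> C" if "S \<subseteq> C" "finite S" for S
    using that(2,1)
  proof induction
    case empty
    then show ?case using eq by (simp add: inf_empty equiv_class_eq_iff)
  next
    case (insert p S)
    have "fst ` S \<subseteq> carrier L" "snd ` S \<subseteq> carrier L" "fst p \<in> carrier L" "snd p \<in> carrier L"
      using insert.prems C by fastforce+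
    then show ?case using insert meet[of "fst p" "snd p"] by (simp add: inf_insert)
  qed
  show "(\<Squnion>(fst ` S), \<Squnion>(snd ` S)) \<in> C" if "S \<subseteq> C" "kset \<kappa> S" for S
  proof (cases "S = {}")
    case True
    then show ?thesis using eq by (simp add: sup_empty equiv_class_eq_iff)
  qed (use that ksup in blast)
qed

context
  fixes C assumes C: "congruence \<kappa> L C"
begin

lemma cong_equiv: "equiv (carrier L) C"
  using C by (simp add: congruence_def)

lemma cong_subset: "C \<subseteq> carrier L \<times> carrier L"
  using cong_equiv by (metis equivE)

lemma cong_fst: "(a, b) \<in> C \<Longrightarrow> a \<in> carrier L" and cong_snd: "(a, b) \<in> C \<Longrightarrow> b \<in> carrier L"
  using cong_subset by auto

lemma cong_refl: "a \<in> carrier L \<Longrightarrow> (a, a) \<in> C"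
  using cong_equiv by (simp add: equiv_class_eq_iff)

lemma cong_sym: "(a, b) \<in> C \<Longrightarrow> (b, a) \<in> C"
  using cong_equiv by (metis equivE symD)

lemma cong_trans: "(a, b) \<in> C \<Longrightarrow> (b, c) \<in> C \<Longrightarrow> (a, c) \<in> C"
  using cong_equiv by (metis equivE transD)

lemma cong_ksup:
  assumes "kset \<kappa> I" "\<And>i. i \<in> I \<Longrightarrow> (f i, g i) \<in> C"
  shows "(\<Squnion>(f ` I), \<Squnion>(g ` I)) \<in> C"
proof -
  have "(\<lambda>i. (f i, g i)) ` I \<subseteq> C" "kset \<kappa> ((\<lambda>i. (f i, g i)) ` I)"
    using assms by (auto intro: kset_image)
  then have "(\<Squnion>(fst ` (\<lambda>i. (f i, g i)) ` I), \<Squnion>(snd ` (\<lambda>i. (f i, g i)) ` I)) \<in> C"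
    using C by (simp add: congruence_def)
  then show ?thesis by (simp add: image_image)
qed

lemma cong_meet:
  assumes "(a, b) \<in> C" "(c, d) \<in> C" shows "(a \<sqinter> c, b \<sqinter> d) \<in> C"
proof -
  have "{(a, b), (c, d)} \<subseteq> C" "finite {(a, b), (c, d)}" using assms by simp_all
  then have "(\<Sqinter>(fst ` {(a, b), (c, d)}), \<Sqinter>(snd ` {(a, b), (c, d)})) \<in> C"
    using C unfolding congruence_def by blast
  then show ?thesis by (simp add: meet_def)
qed

lemma cong_join:
  assumes "(a, b) \<in> C" "(c, d) \<in> C" shows "(a \<squnion> c, b \<squnion> d) \<in> C"
  using cong_ksup[of "{(a, b), (c, d)}" fst snd] assms by (auto simp: join_def kset_finite adm)

lemma cong_clamp:
  "(a, b) \<in> C \<Longrightarrow> c \<in> carrier L \<Longrightarrow> d \<in> carrier L \<Longrightarrow> (clamp c d a, clamp c d b) \<in> C"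
  unfolding clamp_def by (intro cong_meet cong_join cong_refl)

lemma cong_meet_join:
  assumes "(a, b) \<in> C" shows "(a \<sqinter> b, a \<squnion> b) \<in> C"
proof -
  have ab: "a \<in> carrier L" "b \<in> carrier L" using assms cong_fst cong_snd by simp_all
  have "(a \<sqinter> b, b \<sqinter> b) \<in> C" "(b \<squnion> b, a \<squnion> b) \<in> C"
    using assms ab by (simp_all add: cong_meet cong_join cong_refl cong_sym)
  then show ?thesis using ab cong_trans by (simp add: meet_idem join_idem)
qed

text \<open>
  Together with \<open>cong_meet_join\<close> this allows any generator to be replaced by an ordered pair.
\<close>

lemma cong_meet_joinD:
  assumes "(a \<sqinter> b, a \<squnion> b) \<in> C" and ab: "a \<in> carrier L" "b \<in> carrier L"
  shows "(a, b) \<in> C"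
proof -
  have *: "(x, a \<squnion> b) \<in> C" if "x = a \<or> x = b" for x
  proof -
    have x: "x \<in> carrier L" using that ab by auto
    have "(a \<sqinter> b \<squnion> x, a \<squnion> b \<squnion> x) \<in> C" using assms x by (intro cong_join cong_refl)
    moreover have "a \<sqinter> b \<squnion> x = x" using that ab x
      by (metis join_meet_absorb meet_comm)
    moreover have "a \<squnion> b \<squnion> x = a \<squnion> b" using that ab
      by (metis join_assoc join_comm join_idem)
    ultimately show ?thesis by simp
  qed
  show ?thesis by (rule cong_trans[OF * cong_sym[OF *]]) simp_all
qed

end

lemma congruence_clamp_vimage:
  assumes D: "congruence \<kappa> L D" and c: "c \<in> carrier L" "d \<in> carrier L"
  shows "congruence \<kappa> L {(x, y) \<in> carrier L \<times> carrier L. (clamp c d x, clamp c d y) \<in> D}"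
    (is "congruence \<kappa> L ?E")
proof (rule congruenceI)
  show "equiv (carrier L) ?E"
  proof (intro equivI refl_onI symI transI)
    fix x y z assume "(x, y) \<in> ?E" "(y, z) \<in> ?E"
    then show "(x, z) \<in> ?E" using cong_trans[OF D] by auto
  qed (use cong_refl[OF D] cong_sym[OF D] c in auto)
  show "(a \<sqinter> a', b \<sqinter> b') \<in> ?E" if "(a, b) \<in> ?E" "(a', b') \<in> ?E" for a b a' b'
    using that c cong_meet[OF D] by (simp add: clamp_meet)
  show "(\<Squnion>(fst ` S), \<Squnion>(snd ` S)) \<in> ?E" if S: "S \<subseteq> ?E" "kset \<kappa> S" "S \<noteq> {}" for S
  proof -
    have A: "fst ` S \<subseteq> carrier L" "snd ` S \<subseteq> carrier L" "kset \<kappa> (fst ` S)" "kset \<kappa> (snd ` S)"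
      using S by (fastforce intro: kset_image)+
    have "(\<Squnion>((\<lambda>p. clamp c d (fst p)) ` S), \<Squnion>((\<lambda>p. clamp c d (snd p)) ` S)) \<in> D"
      using S by (intro cong_ksup[OF D]) auto
    then show ?thesis using A c S(3) by (simp add: clamp_ksup ksup_closed image_image)
  qed
qed

lemma congruence_Inter:
  assumes "F \<noteq> {}" "\<And>C. C \<in> F \<Longrightarrow> congruence \<kappa> L C"
  shows "congruence \<kappa> L (\<Inter>F)"
proof (rule congruenceI)
  show "equiv (carrier L) (\<Inter>F)"
  proof (intro equivI refl_onI symI transI)
    show "\<Inter>F \<subseteq> carrier L \<times> carrier L" using assms cong_subset by blast
    show "(x, z) \<in> \<Inter>F" if "(x, y) \<in> \<Inter>F" "(y, z) \<in> \<Inter>F" for x y z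
      using that assms cong_trans by (meson InterI InterD)
  qed (use assms cong_refl cong_sym in \<open>meson InterI InterD\<close>)+
  show "(a \<sqinter> c, b \<sqinter> d) \<in> \<Inter>F" if "(a, b) \<in> \<Inter>F" "(c, d) \<in> \<Inter>F" for a b c d
    using that assms cong_meet by blast
  show "(\<Squnion>(fst ` S), \<Squnion>(snd ` S)) \<in> \<Inter>F" if "S \<subseteq> \<Inter>F" "kset \<kappa> S" for S
    using that assms(2) by (force intro: cong_ksup)
qed

lemma congruence_total: "congruence \<kappa> L (carrier L \<times> carrier L)"
proof (rule congruenceI)
  show "equiv (carrier L) (carrier L \<times> carrier L)"
    by (intro equivI refl_onI symI transI) simp_all
  show "(\<Squnion>(fst ` S), \<Squnion>(snd ` S)) \<in> carrier L \<times> carrier L"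
    if "S \<subseteq> carrier L \<times> carrier L" "kset \<kappa> S" for S
    using that by (fastforce intro!: ksup_closed kset_image)
qed simp

lemma congruence_Id: "congruence \<kappa> L (Id_on (carrier L))"
proof (rule congruenceI)
  show "equiv (carrier L) (Id_on (carrier L))"
    by (intro equivI refl_onI symI transI) (simp_all add: Id_on_subset_Times Id_on_iff)
  show "(\<Squnion>(fst ` S), \<Squnion>(snd ` S)) \<in> Id_on (carrier L)"
    if S: "S \<subseteq> Id_on (carrier L)" "kset \<kappa> S" for S
  proof -
    have "fst ` S = snd ` S" "snd ` S \<subseteq> carrier L" using S by force+
    then show ?thesis using S by (simp add: Id_on_iff ksup_closed kset_image)
  qed
qed (simp add: Id_on_iff)

lemma congruence_Int:
  assumes "congruence \<kappa> L C" "congruence \<kappa> L D" shows "congruence \<kappa> L (C \<inter> D)"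
  using congruence_Inter[of "{C, D}"] assms by auto

lemma cgen_superset: "R \<subseteq> cgen \<kappa> L R"
  by (auto simp: cgen_def)

lemma cgen_least: "congruence \<kappa> L C \<Longrightarrow> R \<subseteq> C \<Longrightarrow> cgen \<kappa> L R \<subseteq> C"
  by (auto simp: cgen_def)

lemma congruence_cgen:
  assumes "R \<subseteq> carrier L \<times> carrier L" shows "congruence \<kappa> L (cgen \<kappa> L R)"
  unfolding cgen_def using assms congruence_total by (intro congruence_Inter) auto

lemma cgen_mono_cong:
  "R \<subseteq> cgen \<kappa> L S \<Longrightarrow> S \<subseteq> carrier L \<times> carrier L \<Longrightarrow> cgen \<kappa> L R \<subseteq> cgen \<kappa> L S"
  by (intro cgen_least congruence_cgen)

lemma cgen_Id:
  assumes "R \<subseteq> Id_on (carrier L)" shows "cgen \<kappa> L R = Id_on (carrier L)"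
proof
  show "cgen \<kappa> L R \<subseteq> Id_on (carrier L)" by (rule cgen_least[OF congruence_Id assms])
  have "congruence \<kappa> L (cgen \<kappa> L R)"
    using assms Id_on_subset_Times by (intro congruence_cgen) (rule subset_trans)
  then show "Id_on (carrier L) \<subseteq> cgen \<kappa> L R" using cong_refl by (auto simp: Id_on_def)
qed

text \<open>
  The Heyting implication \<open>C \<rightarrow> D\<close> in disguise. The pairs \<open>(x, y)\<close> with \<open>(clamp c d x, clamp c d y) \<in> D\<close>
  for all ordered pairs \<open>(c, d)\<close> of \<open>C\<close> form an intersection of congruences, which therefore contains
  the congruence generated by \<open>R\<close>. A pair of this intersection that also lies in \<open>C\<close> lies in \<open>D\<close>, because
  one may take for \<open>c\<close> and \<open>d\<close> the meet and the join of the pair itself, and this clamp fixes both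
  elements.
\<close>

lemma Int_cgen_subset:
  assumes C: "congruence \<kappa> L C" and D: "congruence \<kappa> L D"
    and R: "R \<subseteq> carrier L \<times> carrier L"
    and clamp: "\<And>x y c d. (x, y) \<in> R \<Longrightarrow> (c, d) \<in> C \<Longrightarrow> c \<sqsubseteq> d \<Longrightarrow> (clamp c d x, clamp c d y) \<in> D"
  shows "C \<inter> cgen \<kappa> L R \<subseteq> D"
proof -
  define P where "P p = {(x, y) \<in> carrier L \<times> carrier L.
    (clamp (fst p) (snd p) x, clamp (fst p) (snd p) y) \<in> D}" for p
  have "congruence \<kappa> L (P p)" if "p \<in> C" for p
    unfolding P_def using that cong_fst[OF C] cong_snd[OF C]
    by (intro congruence_clamp_vimage[OF D]) (metis prod.collapse)+
  moreover have "R \<subseteq> P p" if "p \<in> C" "fst p \<sqsubseteq> snd p" for p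
    using R clamp that by (force simp: P_def)
  ultimately have sub: "cgen \<kappa> L R \<subseteq> P p" if "p \<in> C" "fst p \<sqsubseteq> snd p" for p
    using that by (intro cgen_least)
  show ?thesis
  proof (safe)
    fix x y assume xy: "(x, y) \<in> C" "(x, y) \<in> cgen \<kappa> L R"
    have c: "x \<in> carrier L" "y \<in> carrier L" using xy cong_fst[OF C] cong_snd[OF C] by simp_all
    have "x \<sqinter> y \<sqsubseteq> x \<squnion> y" using c by (meson le_trans meet_left join_left meet_closed join_closed)
    then have "(x, y) \<in> P (x \<sqinter> y, x \<squnion> y)"
      using sub[of "(x \<sqinter> y, x \<squnion> y)"] cong_meet_join[OF C xy(1)] xy(2) by auto
    moreover have "clamp (x \<sqinter> y) (x \<squnion> y) x = x" "clamp (x \<sqinter> y) (x \<squnion> y) y = y"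
      using c by (simp_all add: clamp_def meet_absorb join_left join_right
          join_comm[of L _ "x \<sqinter> y"] join_absorb meet_left meet_right)
    ultimately show "(x, y) \<in> D" by (simp add: P_def)
  qed
qed

text \<open>
  The converse half of the adjunction: if \<open>C \<inter> E \<subseteq> D\<close>, then \<open>E\<close> lies below \<open>C \<rightarrow> D\<close>. Indeed, for
  \<open>(c, d) \<in> C\<close> all values of \<open>clamp c d\<close> are \<open>C\<close>-related to \<open>c\<close>, so clamping a pair of \<open>E\<close> gives a pair
  of \<open>C \<inter> E\<close>.
\<close>

lemma Int_cgen_Union_subset:
  assumes C: "congruence \<kappa> L C" and D: "congruence \<kappa> L D"
    and F: "\<And>E. E \<in> F \<Longrightarrow> congruence \<kappa> L E" "\<And>E. E \<in> F \<Longrightarrow> C \<inter> E \<subseteq> D"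
  shows "C \<inter> cgen \<kappa> L (\<Union>F) \<subseteq> D"
proof (rule Int_cgen_subset[OF C D])
  show "\<Union>F \<subseteq> carrier L \<times> carrier L" using F(1) cong_subset by (meson Union_least)
  fix x y c d assume xy: "(x, y) \<in> \<Union>F" and cd: "(c, d) \<in> C"
  obtain E where E: "E \<in> F" "(x, y) \<in> E" using xy by (meson UnionE)
  note carr = cong_fst[OF C cd] cong_snd[OF C cd] cong_fst[OF F(1)[OF E(1)] E(2)]
    cong_snd[OF F(1)[OF E(1)] E(2)]
  have cl: "(clamp c d z, c) \<in> C" if z: "z \<in> carrier L" for z
  proof -
    have "(z \<sqinter> d \<squnion> c, z \<sqinter> c \<squnion> c) \<in> C"
      using cong_sym[OF C cd] z carr by (simp add: cong_join[OF C] cong_meet[OF C] cong_refl[OF C])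
    then show ?thesis using carr z by (simp add: clamp_def join_meet_absorb)
  qed
  have "(clamp c d x, clamp c d y) \<in> C \<inter> E"
    using cong_trans[OF C cl cong_sym[OF C cl]] carr cong_clamp[OF F(1)[OF E(1)] E(2)] by simp
  then show "(clamp c d x, clamp c d y) \<in> D" using F(2) E by blast
qed

text \<open>
  Let \<open>T\<close> be the congruence on the right. For \<open>(x, y) \<in> R\<close>, the inverse image of \<open>T\<close> under \<open>clamp x y\<close>
  contains \<open>S\<close>, hence all of \<open>cgen \<kappa> L S\<close>. For an ordered pair \<open>(c, d)\<close> of \<open>cgen \<kappa> L S\<close>, applying \<open>clamp c d\<close>
  exchanges the two intervals and shows that \<open>(clamp c d x, clamp c d y)\<close> lies in \<open>T\<close>, which is the
  hypothesis of \<open>Int_cgen_subset\<close>. The exchange is what forces the pairs of \<open>R\<close> to be ordered.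
\<close>

lemma cgen_Int:
  assumes R: "R \<subseteq> carrier L \<times> carrier L" "\<And>x y. (x, y) \<in> R \<Longrightarrow> x \<sqsubseteq> y"
    and S: "S \<subseteq> carrier L \<times> carrier L"
  shows "cgen \<kappa> L R \<inter> cgen \<kappa> L S
    = cgen \<kappa> L ((\<lambda>((x, y), (c, d)). (clamp x y c, clamp x y d)) ` (R \<times> S))"
    (is "_ = cgen \<kappa> L ?T")
proof
  note cR = congruence_cgen[OF R(1)] and cS = congruence_cgen[OF S]
  have T: "?T \<subseteq> carrier L \<times> carrier L"
    by (auto intro!: clamp_closed dest: subsetD[OF R(1)] subsetD[OF S])
  note cT = congruence_cgen[OF T]
  have "cgen \<kappa> L S \<inter> cgen \<kappa> L R \<subseteq> cgen \<kappa> L ?T"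
  proof (rule Int_cgen_subset[OF cS cT R(1)])
    fix x y c d assume xy: "(x, y) \<in> R" and cd: "(c, d) \<in> cgen \<kappa> L S" "c \<sqsubseteq> d"
    have carr: "x \<in> carrier L" "y \<in> carrier L" using xy R by auto
    have carr2: "c \<in> carrier L" "d \<in> carrier L" using cong_fst[OF cS cd(1)] cong_snd[OF cS cd(1)] .
    have "S \<subseteq> {(u, v) \<in> carrier L \<times> carrier L. (clamp x y u, clamp x y v) \<in> cgen \<kappa> L ?T}"
    proof safe
      fix u v assume "(u, v) \<in> S"
      then have "(clamp x y u, clamp x y v) \<in> ?T"
        using xy by (intro image_eqI[of _ _ "((x, y), (u, v))"]) simp_all
      then show "(clamp x y u, clamp x y v) \<in> cgen \<kappa> L ?T" by (rule subsetD[OF cgen_superset])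
    qed (use S in auto)
    then have "cgen \<kappa> L S \<subseteq> {(u, v) \<in> carrier L \<times> carrier L. (clamp x y u, clamp x y v) \<in> cgen \<kappa> L ?T}"
      using carr by (intro cgen_least congruence_clamp_vimage cT)
    then have "(clamp x y c, clamp x y d) \<in> cgen \<kappa> L ?T" using cd by auto
    then have "(clamp c d (clamp x y c), clamp c d (clamp x y d)) \<in> cgen \<kappa> L ?T"
      by (rule cong_clamp[OF cT _ carr2])
    then show "(clamp c d x, clamp c d y) \<in> cgen \<kappa> L ?T"
      using carr carr2 cd R(2)[OF xy] by (simp add: clamp_clamp_lower clamp_clamp_upper)
  qed
  then show "cgen \<kappa> L R \<inter> cgen \<kappa> L S \<subseteq> cgen \<kappa> L ?T" by blast
  show "cgen \<kappa> L ?T \<subseteq> cgen \<kappa> L R \<inter> cgen \<kappa> L S"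
  proof (rule cgen_least[OF congruence_Int[OF cR cS]], safe)
    fix x y c d assume xy: "(x, y) \<in> R" and cd: "(c, d) \<in> S"
    have carr: "x \<in> carrier L" "y \<in> carrier L" "c \<in> carrier L" "d \<in> carrier L"
      using xy cd R S by auto
    show "(clamp x y c, clamp x y d) \<in> cgen \<kappa> L S"
      using subsetD[OF cgen_superset cd] carr(1,2) by (rule cong_clamp[OF cS])
    have "(clamp x y z, x) \<in> cgen \<kappa> L R" if z: "z \<in> carrier L" for z
    proof -
      have "(z \<sqinter> y \<squnion> x, z \<sqinter> x \<squnion> x) \<in> cgen \<kappa> L R"
        using cong_sym[OF cR subsetD[OF cgen_superset xy]] z carr
        by (simp add: cong_join[OF cR] cong_meet[OF cR] cong_refl[OF cR])
      then show ?thesis using carr z by (simp add: clamp_def join_meet_absorb)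
    qed
    from cong_trans[OF cR this cong_sym[OF cR this]]
    show "(clamp x y c, clamp x y d) \<in> cgen \<kappa> L R" using carr by simp
  qed
qed


section \<open>The \<open>\<kappa>\<close>-frame of \<open>\<kappa>\<close>-generated congruences\<close>

abbreviation K where "K \<equiv> kcong_lattice \<kappa> L"

lemma kcong_le [simp]: "A \<sqsubseteq>\<^bsub>K\<^esub> B \<longleftrightarrow> A \<subseteq> B"
  by (simp add: kcong_lattice_def)

lemma kcong_cgen: "R \<subseteq> carrier L \<times> carrier L \<Longrightarrow> kset \<kappa> R \<Longrightarrow> cgen \<kappa> L R \<in> carrier K"
  by (auto simp: kcong_lattice_def)

lemma kcong_congruence: "A \<in> carrier K \<Longrightarrow> congruence \<kappa> L A"
  by (auto simp: kcong_lattice_def intro: congruence_cgen)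

lemma kcong_ordered_generators:
  assumes "A \<in> carrier K"
  obtains R where "R \<subseteq> carrier L \<times> carrier L" "kset \<kappa> R" "\<And>x y. (x, y) \<in> R \<Longrightarrow> x \<sqsubseteq> y"
    "A = cgen \<kappa> L R"
proof -
  obtain R where R: "R \<subseteq> carrier L \<times> carrier L" "kset \<kappa> R" "A = cgen \<kappa> L R"
    using assms by (auto simp: kcong_lattice_def)
  define R' where "R' = (\<lambda>(a, b). (a \<sqinter> b, a \<squnion> b)) ` R"
  have R': "R' \<subseteq> carrier L \<times> carrier L" using R by (auto simp: R'_def)
  have "cgen \<kappa> L R \<subseteq> cgen \<kappa> L R'"
  proof (rule cgen_mono_cong[OF _ R'], rule subrelI)
    fix a b assume ab: "(a, b) \<in> R"
    then have "(a \<sqinter> b, a \<squnion> b) \<in> cgen \<kappa> L R'"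
      by (intro subsetD[OF cgen_superset]) (force simp: R'_def)
    moreover have "a \<in> carrier L" "b \<in> carrier L" using ab R by auto
    ultimately show "(a, b) \<in> cgen \<kappa> L R'" by (rule cong_meet_joinD[OF congruence_cgen[OF R']])
  qed
  moreover have "cgen \<kappa> L R' \<subseteq> cgen \<kappa> L R"
    using cong_meet_join[OF congruence_cgen[OF R(1)] subsetD[OF cgen_superset]] R(1)
    by (intro cgen_mono_cong) (auto simp: R'_def)
  moreover have "kset \<kappa> R'" using R(2) by (auto simp: R'_def intro: kset_image)
  moreover have "x \<sqsubseteq> y" if xy: "(x, y) \<in> R'" for x y
  proof -
    obtain p where p: "p \<in> R" "x = fst p \<sqinter> snd p" "y = fst p \<squnion> snd p"
      using xy by (auto simp: R'_def)
    then have "fst p \<in> carrier L" "snd p \<in> carrier L" using R(1) by auto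
    then show ?thesis unfolding p(2,3)
      by (meson le_trans meet_left join_left meet_closed join_closed)
  qed
  ultimately show thesis using R R' by (intro that[of R']) auto
qed

lemma kcong_Int:
  assumes "A \<in> carrier K" "B \<in> carrier K" shows "A \<inter> B \<in> carrier K"
proof -
  obtain R where R: "R \<subseteq> carrier L \<times> carrier L" "kset \<kappa> R" "\<And>x y. (x, y) \<in> R \<Longrightarrow> x \<sqsubseteq> y"
    "A = cgen \<kappa> L R" using kcong_ordered_generators[OF assms(1)] by metis
  obtain S where S: "S \<subseteq> carrier L \<times> carrier L" "kset \<kappa> S" "B = cgen \<kappa> L S"
    using kcong_ordered_generators[OF assms(2)] by metis
  have "A \<inter> B = cgen \<kappa> L ((\<lambda>((x, y), (c, d)). (clamp x y c, clamp x y d)) ` (R \<times> S))"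
    unfolding R(4) S(3) using R(3) by (intro cgen_Int R(1) S(1))
  then show ?thesis
    by (simp only:, intro kcong_cgen kset_image kset_Times adm R(2) S(2))
       (auto intro!: clamp_closed dest: subsetD[OF R(1)] subsetD[OF S(1)])
qed

lemma kcong_cgen_Union:
  assumes "F \<subseteq> carrier K" "kset \<kappa> F" shows "cgen \<kappa> L (\<Union>F) \<in> carrier K"
proof -
  have "\<forall>A\<in>F. \<exists>R. R \<subseteq> carrier L \<times> carrier L \<and> kset \<kappa> R \<and> A = cgen \<kappa> L R"
    using assms(1) by (auto simp: kcong_lattice_def)
  then obtain R where R: "\<And>A. A \<in> F \<Longrightarrow> R A \<subseteq> carrier L \<times> carrier L"
    "\<And>A. A \<in> F \<Longrightarrow> kset \<kappa> (R A)" "\<And>A. A \<in> F \<Longrightarrow> A = cgen \<kappa> L (R A)" by metis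
  let ?R = "\<Union>A\<in>F. R A"
  have sub: "?R \<subseteq> carrier L \<times> carrier L" using R(1) by (rule UN_least)
  have F: "\<Union>F \<subseteq> carrier L \<times> carrier L"
    using assms(1) kcong_congruence cong_subset by (meson Union_least subsetD)
  have "cgen \<kappa> L (\<Union>F) \<subseteq> cgen \<kappa> L ?R"
  proof (rule cgen_mono_cong[OF _ sub], rule Union_least)
    fix A assume A: "A \<in> F"
    have "cgen \<kappa> L (R A) \<subseteq> cgen \<kappa> L ?R"
      using sub A by (intro cgen_mono_cong subset_trans[OF _ cgen_superset]) auto
    then show "A \<subseteq> cgen \<kappa> L ?R" using R(3)[OF A] by simp
  qed
  moreover have "cgen \<kappa> L ?R \<subseteq> cgen \<kappa> L (\<Union>F)"
  proof (rule cgen_mono_cong[OF _ F], rule UN_least)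
    fix A assume A: "A \<in> F"
    have "R A \<subseteq> A" using R(3)[OF A] cgen_superset by metis
    also have "A \<subseteq> cgen \<kappa> L (\<Union>F)" using A cgen_superset[of "\<Union>F"] by auto
    finally show "R A \<subseteq> cgen \<kappa> L (\<Union>F)" .
  qed
  ultimately have "cgen \<kappa> L (\<Union>F) = cgen \<kappa> L ?R" by (rule equalityI)
  then show ?thesis using sub assms(2) R(2) by (simp add: kcong_cgen kset_UN adm)
qed

lemma kcong_partial_order: "partial_order K"
  by unfold_locales (auto simp: kcong_lattice_def)

lemma kcong_least:
  assumes "F \<subseteq> carrier K" "kset \<kappa> F" shows "least K (cgen \<kappa> L (\<Union>F)) (Upper K F)"
proof (rule least_UpperI)
  show "A \<sqsubseteq>\<^bsub>K\<^esub> cgen \<kappa> L (\<Union>F)" if "A \<in> F" for A using that cgen_superset[of "\<Union>F"] by auto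
  show "cgen \<kappa> L (\<Union>F) \<sqsubseteq>\<^bsub>K\<^esub> B" if "B \<in> Upper K F" for B
  proof -
    have "B \<in> carrier K" "\<Union>F \<subseteq> B" using that assms(1) unfolding Upper_def by auto
    then show ?thesis by (simp add: kcong_congruence cgen_least)
  qed
qed (use assms kcong_cgen_Union in auto)

lemma kcong_greatest:
  assumes "A \<in> carrier K" "B \<in> carrier K" shows "greatest K (A \<inter> B) (Lower K {A, B})"
  using assms kcong_Int by (intro greatest_LowerI) (auto simp: Lower_def)

lemma kcong_Sup: "F \<subseteq> carrier K \<Longrightarrow> kset \<kappa> F \<Longrightarrow> \<Squnion>\<^bsub>K\<^esub>F = cgen \<kappa> L (\<Union>F)"
  by (intro partial_order.Sup_eqI kcong_partial_order kcong_least)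

lemma kcong_join:
  "A \<in> carrier K \<Longrightarrow> B \<in> carrier K \<Longrightarrow> A \<squnion>\<^bsub>K\<^esub> B = cgen \<kappa> L (A \<union> B)"
  using kcong_Sup[of "{A, B}"] by (simp add: join_def kset_finite adm)

lemma kcong_meet: "A \<in> carrier K \<Longrightarrow> B \<in> carrier K \<Longrightarrow> A \<sqinter>\<^bsub>K\<^esub> B = A \<inter> B"
  unfolding meet_def by (intro partial_order.Inf_eqI kcong_partial_order kcong_greatest)

lemma Id_kcong: "Id_on (carrier L) \<in> carrier K"
  using kcong_cgen[of "{}"] cgen_Id[of "{}"] by (simp add: kset_finite adm)

lemma cgen_bot_top: "cgen \<kappa> L {(\<bottom>, \<top>)} = carrier L \<times> carrier L"
proof
  have bt: "{(\<bottom>, \<top>)} \<subseteq> carrier L \<times> carrier L" by simp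
  note C = congruence_cgen[OF bt]
  show "cgen \<kappa> L {(\<bottom>, \<top>)} \<subseteq> carrier L \<times> carrier L" using cong_subset[OF C] .
  have *: "(\<bottom>, x) \<in> cgen \<kappa> L {(\<bottom>, \<top>)}" if "x \<in> carrier L" for x
    using cong_meet[OF C subsetD[OF cgen_superset] cong_refl[OF C that], of \<bottom> \<top>] that
    by (simp add: meet_absorb meet_comm[of L \<top>])
  show "carrier L \<times> carrier L \<subseteq> cgen \<kappa> L {(\<bottom>, \<top>)}"
    using cong_trans[OF C cong_sym[OF C *] *] by auto
qed

lemma total_kcong: "carrier L \<times> carrier L \<in> carrier K"
  using kcong_cgen[of "{(\<bottom>, \<top>)}"] by (simp add: kset_finite adm cgen_bot_top)

lemma kcong_bounds:
  assumes "A \<in> carrier K" shows "Id_on (carrier L) \<subseteq> A" "A \<subseteq> carrier L \<times> carrier L"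
  using cong_refl[OF kcong_congruence[OF assms]] cong_subset[OF kcong_congruence[OF assms]]
  by (auto simp: Id_on_def)

lemma kcong_Int_Sup:
  assumes A: "A \<in> carrier K" and F: "F \<subseteq> carrier K" "kset \<kappa> F"
  shows "A \<inter> cgen \<kappa> L (\<Union>F) = cgen \<kappa> L (\<Union>((\<inter>) A ` F))"
proof
  have AF: "(\<inter>) A ` F \<subseteq> carrier K" "kset \<kappa> ((\<inter>) A ` F)"
    using kcong_Int[OF A subsetD[OF F(1)]] F(2) by (auto intro: kset_image)
  note D = kcong_congruence[OF kcong_cgen_Union[OF AF]]
  show "A \<inter> cgen \<kappa> L (\<Union>F) \<subseteq> cgen \<kappa> L (\<Union>((\<inter>) A ` F))"
  proof (rule Int_cgen_Union_subset[OF kcong_congruence[OF A] D])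
    fix E assume E: "E \<in> F"
    show "congruence \<kappa> L E" using E F kcong_congruence by auto
    have "A \<inter> E \<subseteq> \<Union>((\<inter>) A ` F)" using E by auto
    also have "\<dots> \<subseteq> cgen \<kappa> L (\<Union>((\<inter>) A ` F))" by (rule cgen_superset)
    finally show "A \<inter> E \<subseteq> cgen \<kappa> L (\<Union>((\<inter>) A ` F))" .
  qed
  have "\<Union>((\<inter>) A ` F) \<subseteq> cgen \<kappa> L (\<Union>F)"
    by (rule subset_trans[OF _ cgen_superset]) auto
  then show "cgen \<kappa> L (\<Union>((\<inter>) A ` F)) \<subseteq> A \<inter> cgen \<kappa> L (\<Union>F)"
    by (intro cgen_least congruence_Int kcong_congruence A kcong_cgen_Union F) auto
qed

lemma kcong_kframe: "kframe \<kappa> K"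
proof -
  interpret po: partial_order K by (rule kcong_partial_order)
  show ?thesis
  proof unfold_locales
    show "\<exists>s. least K s (Upper K {A, B})" if "A \<in> carrier K" "B \<in> carrier K" for A B
      using kcong_least[of "{A, B}"] that by (auto simp: kset_finite adm)
    show "\<exists>s. greatest K s (Lower K {A, B})" if "A \<in> carrier K" "B \<in> carrier K" for A B
      using kcong_greatest that by blast
    show "\<exists>s. least K s (carrier K)"
      using Id_kcong kcong_bounds(1) by (intro exI[of _ "Id_on (carrier L)"]) (auto simp: least_def)
    show "\<exists>s. greatest K s (carrier K)"
      using total_kcong kcong_bounds(2) by (intro exI[of _ "carrier L \<times> carrier L"]) (auto simp: greatest_def)
    show "\<exists>s. least K s (Upper K F)" if "F \<subseteq> carrier K" "kset \<kappa> F" for F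
      using kcong_least that by blast
    show "A \<sqinter>\<^bsub>K\<^esub> \<Squnion>\<^bsub>K\<^esub>F = \<Squnion>\<^bsub>K\<^esub>((\<sqinter>\<^bsub>K\<^esub>) A ` F)"
      if A: "A \<in> carrier K" and F: "F \<subseteq> carrier K" "kset \<kappa> F" for A F
    proof -
      have "(\<sqinter>\<^bsub>K\<^esub>) A ` F = (\<inter>) A ` F"
        using A F by (intro image_cong) (auto simp: kcong_meet)
      moreover have "(\<inter>) A ` F \<subseteq> carrier K" using A F kcong_Int by auto
      ultimately show ?thesis
        using A F by (simp add: kcong_Sup kcong_meet kcong_cgen_Union kset_image kcong_Int_Sup)
    qed
    show "A \<sqinter>\<^bsub>K\<^esub> (B \<squnion>\<^bsub>K\<^esub> D) = A \<sqinter>\<^bsub>K\<^esub> B \<squnion>\<^bsub>K\<^esub> A \<sqinter>\<^bsub>K\<^esub> D"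
      if "A \<in> carrier K" "B \<in> carrier K" "D \<in> carrier K" for A B D
    proof -
      have "cgen \<kappa> L (B \<union> D) \<in> carrier K"
        using kcong_cgen_Union[of "{B, D}"] that by (simp add: kset_finite adm)
      then show ?thesis using that kcong_Int_Sup[of A "{B, D}"]
        by (simp add: kcong_join kcong_meet kcong_Int kset_finite adm)
    qed
  qed
qed


lemma kcong_admissible_kframe: "admissible_kframe \<kappa> K"
  by (intro admissible_kframe.intro admissible_kframe_axioms.intro kcong_kframe adm)

lemma kcong_bottom: "\<bottom>\<^bsub>K\<^esub> = Id_on (carrier L)"
proof -
  interpret K: admissible_kframe \<kappa> K by (rule kcong_admissible_kframe)
  show ?thesis using K.bottom_eq[OF Id_kcong] kcong_bounds by simp
qed

lemma kcong_top: "\<top>\<^bsub>K\<^esub> = carrier L \<times> carrier L"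
proof -
  interpret K: admissible_kframe \<kappa> K by (rule kcong_admissible_kframe)
  show ?thesis using K.top_eq[OF total_kcong] kcong_bounds by simp
qed

lemma kcong_principal: "a \<in> carrier L \<Longrightarrow> b \<in> carrier L \<Longrightarrow> cgen \<kappa> L {(a, b)} \<in> carrier K"
  by (simp add: kcong_cgen kset_finite adm)

lemma cgen_cgen_Un:
  assumes R: "R \<subseteq> carrier L \<times> carrier L" and S: "S \<subseteq> carrier L \<times> carrier L"
  shows "cgen \<kappa> L (cgen \<kappa> L R \<union> S) = cgen \<kappa> L (R \<union> S)"
proof
  have RS: "R \<union> S \<subseteq> carrier L \<times> carrier L" using R S by simp
  have cRS: "cgen \<kappa> L R \<union> S \<subseteq> carrier L \<times> carrier L"
    using cong_subset[OF congruence_cgen[OF R]] S by simp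
  show "cgen \<kappa> L (cgen \<kappa> L R \<union> S) \<subseteq> cgen \<kappa> L (R \<union> S)"
    using cgen_superset[of "R \<union> S"] RS by (intro cgen_mono_cong Un_least) auto
  show "cgen \<kappa> L (R \<union> S) \<subseteq> cgen \<kappa> L (cgen \<kappa> L R \<union> S)"
    using cgen_superset[of R] cgen_superset[of "cgen \<kappa> L R \<union> S"] cRS
    by (intro cgen_mono_cong) auto
qed

lemma kcong_join_cgen:
  assumes R: "R \<subseteq> carrier L \<times> carrier L" "kset \<kappa> R" and A: "A \<in> carrier K"
  shows "cgen \<kappa> L R \<squnion>\<^bsub>K\<^esub> A = cgen \<kappa> L (R \<union> A)"
  using R A by (simp add: kcong_join kcong_cgen cgen_cgen_Un kcong_bounds)

lemma clamp_bot: "c \<in> carrier L \<Longrightarrow> d \<in> carrier L \<Longrightarrow> clamp c d \<bottom> = c"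
  by (simp add: clamp_def meet_absorb join_absorb)

lemma clamp_top: "c \<in> carrier L \<Longrightarrow> d \<in> carrier L \<Longrightarrow> c \<sqsubseteq> d \<Longrightarrow> clamp c d \<top> = d"
  by (simp add: clamp_def meet_comm[of L \<top>] meet_absorb join_comm[of L d] join_absorb)

lemma clamp_lower: "c \<in> carrier L \<Longrightarrow> d \<in> carrier L \<Longrightarrow> clamp c d c = c"
  by (simp add: clamp_def join_absorb meet_left)

lemma clamp_upper: "c \<in> carrier L \<Longrightarrow> d \<in> carrier L \<Longrightarrow> c \<sqsubseteq> d \<Longrightarrow> clamp c d d = d"
  by (simp add: clamp_def meet_idem join_comm[of L d] join_absorb)

lemma clamp_from_bot: "d \<in> carrier L \<Longrightarrow> x \<in> carrier L \<Longrightarrow> clamp \<bottom> d x = x \<sqinter> d"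
  by (simp add: clamp_def join_comm[of L _ \<bottom>] join_absorb)

lemma clamp_to_top: "c \<in> carrier L \<Longrightarrow> x \<in> carrier L \<Longrightarrow> clamp c \<top> x = x \<squnion> c"
  by (simp add: clamp_def meet_absorb)

text \<open>
  By \<open>cgen_Int\<close> the meet is generated by the values of \<open>clamp c d\<close> at the pairs \<open>(\<bottom>, c)\<close> and \<open>(d, \<top>)\<close>,
  which are the trivial pairs \<open>(c, c)\<close> and \<open>(d, d)\<close>. The join relates \<open>\<bottom>\<close>, \<open>c\<close>, \<open>d\<close> and \<open>\<top>\<close> in a chain.
\<close>

lemma principal_complement:
  assumes c: "c \<in> carrier L" "d \<in> carrier L" "c \<sqsubseteq> d"
  shows "cgen \<kappa> L {(c, d)} \<sqinter>\<^bsub>K\<^esub> cgen \<kappa> L {(\<bottom>, c), (d, \<top>)} = \<bottom>\<^bsub>K\<^esub>"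
    and "cgen \<kappa> L {(c, d)} \<squnion>\<^bsub>K\<^esub> cgen \<kappa> L {(\<bottom>, c), (d, \<top>)} = \<top>\<^bsub>K\<^esub>"
proof -
  have mem: "cgen \<kappa> L {(c, d)} \<in> carrier K" "cgen \<kappa> L {(\<bottom>, c), (d, \<top>)} \<in> carrier K"
    using c by (simp_all add: kcong_cgen kset_finite adm)
  have "cgen \<kappa> L {(c, d)} \<inter> cgen \<kappa> L {(\<bottom>, c), (d, \<top>)}
      = cgen \<kappa> L ((\<lambda>((x, y), (c, d)). (clamp x y c, clamp x y d)) ` ({(c, d)} \<times> {(\<bottom>, c), (d, \<top>)}))"
    using c by (intro cgen_Int) auto
  also have "\<dots> = Id_on (carrier L)"
    using c by (intro cgen_Id) (auto simp: clamp_bot clamp_top clamp_lower clamp_upper)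
  finally show "cgen \<kappa> L {(c, d)} \<sqinter>\<^bsub>K\<^esub> cgen \<kappa> L {(\<bottom>, c), (d, \<top>)} = \<bottom>\<^bsub>K\<^esub>"
    using mem by (simp add: kcong_meet kcong_bottom)
  let ?R = "{(c, d)} \<union> {(\<bottom>, c), (d, \<top>)}"
  have R: "?R \<subseteq> carrier L \<times> carrier L" using c by simp
  note C = congruence_cgen[OF R]
  have "(\<bottom>, \<top>) \<in> cgen \<kappa> L ?R"
    by (rule cong_trans[OF C cong_trans[OF C, of _ c d]]; rule subsetD[OF cgen_superset]; simp)
  then have "cgen \<kappa> L {(\<bottom>, \<top>)} \<subseteq> cgen \<kappa> L ?R" using R by (intro cgen_mono_cong) auto
  then have "cgen \<kappa> L ?R = carrier L \<times> carrier L"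
    using cgen_bot_top cong_subset[OF C] by auto
  moreover have "cgen \<kappa> L {(c, d)} \<squnion>\<^bsub>K\<^esub> cgen \<kappa> L {(\<bottom>, c), (d, \<top>)} = cgen \<kappa> L ?R"
    using c mem cgen_cgen_Un[of "{(\<bottom>, c), (d, \<top>)}" "{(c, d)}"]
    by (simp add: kcong_join_cgen kset_finite adm Un_commute insert_commute)
  ultimately show "cgen \<kappa> L {(c, d)} \<squnion>\<^bsub>K\<^esub> cgen \<kappa> L {(\<bottom>, c), (d, \<top>)} = \<top>\<^bsub>K\<^esub>"
    by (simp add: kcong_top)
qed

lemma kcong_Sup_principal:
  assumes "R \<subseteq> carrier L \<times> carrier L" "kset \<kappa> R"
  shows "cgen \<kappa> L R = \<Squnion>\<^bsub>K\<^esub>((\<lambda>p. cgen \<kappa> L {p}) ` R)"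
proof -
  let ?F = "(\<lambda>p. cgen \<kappa> L {p}) ` R"
  have F: "?F \<subseteq> carrier K" "kset \<kappa> ?F"
    using assms by (auto intro!: kset_image kcong_principal)
  have sub: "\<Union>?F \<subseteq> carrier L \<times> carrier L"
    using F kcong_bounds(2) by (meson Union_least subsetD)
  have "cgen \<kappa> L {p} \<subseteq> cgen \<kappa> L R" if "p \<in> R" for p
    using assms(1) that cgen_superset[of R] by (intro cgen_mono_cong) auto
  then have "cgen \<kappa> L (\<Union>?F) \<subseteq> cgen \<kappa> L R" using assms(1) by (intro cgen_mono_cong) auto
  moreover have "R \<subseteq> \<Union>?F" using cgen_superset by fastforce
  then have "cgen \<kappa> L R \<subseteq> cgen \<kappa> L (\<Union>?F)"
    using sub cgen_superset[of "\<Union>?F"] by (intro cgen_mono_cong) (rule subset_trans)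
  ultimately show ?thesis using F by (simp add: kcong_Sup)
qed

lemma kcong_zero_dimensional: "zero_dimensional \<kappa> K"
  unfolding zero_dimensional_def
proof
  fix A assume "A \<in> carrier K"
  then obtain R where R: "R \<subseteq> carrier L \<times> carrier L" "kset \<kappa> R" "\<And>x y. (x, y) \<in> R \<Longrightarrow> x \<sqsubseteq> y"
    "A = cgen \<kappa> L R" using kcong_ordered_generators by metis
  have "complemented K (cgen \<kappa> L {(c, d)})" if "(c, d) \<in> R" for c d
  proof -
    have c: "c \<in> carrier L" "d \<in> carrier L" "c \<sqsubseteq> d" using that R by auto
    then have "cgen \<kappa> L {(\<bottom>, c), (d, \<top>)} \<in> carrier K" by (simp add: kcong_cgen kset_finite adm)
    with principal_complement[OF c] show ?thesis
      unfolding complemented_def using c kcong_principal by blast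
  qed
  then show "\<exists>S. S \<subseteq> {c. complemented K c} \<and> kset \<kappa> S \<and> A = \<Squnion>\<^bsub>K\<^esub>S"
    using R kcong_Sup_principal[OF R(1,2)]
    by (intro exI[of _ "(\<lambda>p. cgen \<kappa> L {p}) ` R"]) (auto intro: kset_image)
qed

section \<open>The embedding of a \<open>\<kappa>\<close>-frame into its \<open>\<kappa>\<close>-frame of congruences\<close>

lemma nabla_closed: "a \<in> carrier L \<Longrightarrow> nabla \<kappa> L a \<in> carrier K"
  by (simp add: nabla_def kcong_principal)

text \<open>
  The right-hand side is the kernel of \<open>clamp b \<top>\<close>, hence a congruence, and it contains \<open>(\<bottom>, b)\<close>.
  Conversely, joining with the generator \<open>(\<bottom>, b)\<close> relates every \<open>z\<close> to \<open>z \<squnion> b\<close>.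
\<close>

lemma nabla_iff:
  assumes b: "b \<in> carrier L"
  shows "(x, y) \<in> nabla \<kappa> L b \<longleftrightarrow> x \<in> carrier L \<and> y \<in> carrier L \<and> x \<squnion> b = y \<squnion> b"
proof
  assume xy: "(x, y) \<in> nabla \<kappa> L b"
  have "nabla \<kappa> L b \<subseteq> {(x, y) \<in> carrier L \<times> carrier L. (clamp b \<top> x, clamp b \<top> y) \<in> Id_on (carrier L)}"
    unfolding nabla_def using b
    by (intro cgen_least congruence_clamp_vimage congruence_Id)
       (simp_all add: clamp_to_top join_idem join_absorb Id_on_iff)
  then show "x \<in> carrier L \<and> y \<in> carrier L \<and> x \<squnion> b = y \<squnion> b"
    using xy b by (auto simp: clamp_to_top)
next
  assume xy: "x \<in> carrier L \<and> y \<in> carrier L \<and> x \<squnion> b = y \<squnion> b"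
  have C: "congruence \<kappa> L (nabla \<kappa> L b)" using b by (simp add: nabla_def congruence_cgen)
  have b0: "(\<bottom>, b) \<in> nabla \<kappa> L b" unfolding nabla_def using cgen_superset by blast
  have *: "(z, z \<squnion> b) \<in> nabla \<kappa> L b" if "z \<in> carrier L" for z
    using cong_join[OF C cong_refl[OF C that] b0] that
    by (simp add: join_comm[of L z \<bottom>] join_absorb)
  show "(x, y) \<in> nabla \<kappa> L b" using cong_trans[OF C *[of x] cong_sym[OF C]] *[of y] xy by simp
qed

lemma nabla_mono_iff:
  assumes "a \<in> carrier L" "b \<in> carrier L"
  shows "nabla \<kappa> L a \<subseteq> nabla \<kappa> L b \<longleftrightarrow> a \<sqsubseteq> b"
proof -
  have "nabla \<kappa> L a \<subseteq> nabla \<kappa> L b \<longleftrightarrow> (\<bottom>, a) \<in> nabla \<kappa> L b"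
    using cgen_superset[of "{(\<bottom>, a)}"] cgen_least[OF kcong_congruence[OF nabla_closed], of b "{(\<bottom>, a)}"] assms
    unfolding nabla_def by auto
  also have "\<dots> \<longleftrightarrow> a \<squnion> b = b" using assms by (auto simp: nabla_iff join_absorb)
  also have "\<dots> \<longleftrightarrow> a \<sqsubseteq> b" using assms le_iff_meet by simp
  finally show ?thesis .
qed

text \<open>
  Besides meets of the \<open>\<nabla>\<^sub>a\<close>, this yields every principal congruence: for \<open>c \<sqsubseteq> a\<close> and \<open>d = \<top>\<close> the
  right-hand side is generated by \<open>(c, a)\<close>.
\<close>

lemma nabla_Int_principal:
  assumes "a \<in> carrier L" "c \<in> carrier L" "d \<in> carrier L"
  shows "nabla \<kappa> L a \<inter> cgen \<kappa> L {(c, d)} = cgen \<kappa> L {(c \<sqinter> a, d \<sqinter> a)}"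
  unfolding nabla_def using assms
  by (subst cgen_Int) (auto simp: clamp_from_bot)

lemma nabla_meet:
  assumes "a \<in> carrier L" "b \<in> carrier L"
  shows "nabla \<kappa> L (a \<sqinter> b) = nabla \<kappa> L a \<sqinter>\<^bsub>K\<^esub> nabla \<kappa> L b"
  using nabla_Int_principal[of a \<bottom> b] assms
  by (simp add: kcong_meet nabla_closed meet_absorb meet_comm[of L b]) (simp add: nabla_def)

lemma nabla_hom: "kframe_hom \<kappa> L K (nabla \<kappa> L)"
proof -
  interpret K: admissible_kframe \<kappa> K by (rule kcong_admissible_kframe)
  have "nabla \<kappa> L (\<Sqinter>A) = \<Sqinter>\<^bsub>K\<^esub>(nabla \<kappa> L ` A)" if "finite A" "A \<subseteq> carrier L" for A
    using that
  proof induction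
    case empty
    then show ?case by (simp add: inf_empty K.inf_empty kcong_top nabla_def cgen_bot_top)
  next
    case (insert a A)
    have "nabla \<kappa> L ` A \<subseteq> carrier K" using insert.prems nabla_closed by auto
    then show ?case using insert
      by (simp add: inf_insert K.inf_insert nabla_meet nabla_closed finite_inf_closed)
  qed
  moreover have "nabla \<kappa> L (\<Squnion>A) = \<Squnion>\<^bsub>K\<^esub>(nabla \<kappa> L ` A)" if A: "A \<subseteq> carrier L" "kset \<kappa> A" for A
  proof (rule K.sup_eqI[symmetric])
    show "nabla \<kappa> L ` A \<subseteq> carrier K" using A nabla_closed by auto
    show "nabla \<kappa> L (\<Squnion>A) \<in> carrier K" using A by (simp add: nabla_closed ksup_closed)
    show "B \<sqsubseteq>\<^bsub>K\<^esub> nabla \<kappa> L (\<Squnion>A)" if B: "B \<in> nabla \<kappa> L ` A" for B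
    proof -
      obtain a where a: "a \<in> A" "B = nabla \<kappa> L a" using B by auto
      then show ?thesis using A nabla_mono_iff[of a "\<Squnion>A"] ksup_upper ksup_closed by auto
    qed
    show "nabla \<kappa> L (\<Squnion>A) \<sqsubseteq>\<^bsub>K\<^esub> U" if U: "U \<in> carrier K" "\<And>B. B \<in> nabla \<kappa> L ` A \<Longrightarrow> B \<sqsubseteq>\<^bsub>K\<^esub> U" for U
    proof -
      note C = kcong_congruence[OF U(1)]
      have aU: "(\<bottom>, a) \<in> U" if "a \<in> A" for a
        using U(2) that cgen_superset[of "{(\<bottom>, a)}"] by (auto simp: nabla_def)
      then have "(\<Squnion>((\<lambda>a. \<bottom>) ` A), \<Squnion>((\<lambda>a. a) ` A)) \<in> U" using A by (intro cong_ksup[OF C])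
      moreover have "\<Squnion>((\<lambda>a. \<bottom>) ` A) = \<bottom>" by (intro sup_eqI) auto
      ultimately have "(\<bottom>, \<Squnion>A) \<in> U" by simp
      then show ?thesis using cgen_least[OF C] by (simp add: nabla_def)
    qed
  qed
  ultimately show ?thesis
    unfolding kframe_hom_def using nabla_closed kcong_kframe kframe_axioms by auto
qed

lemma nabla_inj: "inj_on (nabla \<kappa> L) (carrier L)"
  using nabla_mono_iff le_antisym by (intro inj_onI) (metis subset_refl)


section \<open>Quotients\<close>

context
  fixes C assumes C: "congruence \<kappa> L C"
begin

lemma quot_carrier: "carrier (quot L C) = (\<lambda>a. C `` {a}) ` carrier L"
  by (auto simp: quot_def quotient_def)

lemma class_closed: "a \<in> carrier L \<Longrightarrow> C `` {a} \<in> carrier (quot L C)"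
  by (simp add: quot_carrier)

lemma class_eq_iff:
  "a \<in> carrier L \<Longrightarrow> b \<in> carrier L \<Longrightarrow> C `` {a} = C `` {b} \<longleftrightarrow> (a, b) \<in> C"
  using eq_equiv_class_iff[OF cong_equiv[OF C]] .

text \<open>
  The order of the quotient is stated through some representatives; it does not depend on them.
\<close>

lemma class_le_iff:
  assumes ab: "a \<in> carrier L" "b \<in> carrier L"
  shows "C `` {a} \<sqsubseteq>\<^bsub>quot L C\<^esub> C `` {b} \<longleftrightarrow> (a \<sqinter> b, a) \<in> C"
proof
  assume "C `` {a} \<sqsubseteq>\<^bsub>quot L C\<^esub> C `` {b}"
  then obtain a' b' where *: "(a, a') \<in> C" "(b, b') \<in> C" "C `` {a' \<sqinter> b'} = C `` {a}"
    by (auto simp: quot_def)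
  have "a' \<sqinter> b' \<in> carrier L" using * cong_snd[OF C] by simp
  then have "(a' \<sqinter> b', a) \<in> C" using * ab by (simp add: class_eq_iff)
  from cong_trans[OF C cong_meet[OF C *(1,2)] this] show "(a \<sqinter> b, a) \<in> C" .
next
  assume "(a \<sqinter> b, a) \<in> C"
  then have "C `` {a \<sqinter> b} = C `` {a}" using ab by (simp add: class_eq_iff)
  then show "C `` {a} \<sqsubseteq>\<^bsub>quot L C\<^esub> C `` {b}" using ab cong_refl[OF C] by (auto simp: quot_def)
qed

lemma quot_partial_order: "partial_order (quot L C)"
proof unfold_locales
  show "(.=\<^bsub>quot L C\<^esub>) = (=)" by (simp add: quot_def)
  fix X Y Z assume "X \<in> carrier (quot L C)" "Y \<in> carrier (quot L C)" "Z \<in> carrier (quot L C)"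
  then obtain x y z where x: "x \<in> carrier L" "X = C `` {x}" and y: "y \<in> carrier L" "Y = C `` {y}"
    and z: "z \<in> carrier L" "Z = C `` {z}" by (auto simp: quot_carrier)
  note cl = x(1) y(1) z(1)
  show "X .=\<^bsub>quot L C\<^esub> Y" if le: "X \<sqsubseteq>\<^bsub>quot L C\<^esub> Y" "Y \<sqsubseteq>\<^bsub>quot L C\<^esub> X"
  proof -
    have xy: "(x \<sqinter> y, x) \<in> C" and yx: "(x \<sqinter> y, y) \<in> C"
      using le cl unfolding x y by (simp_all add: class_le_iff meet_comm[of L y])
    have "(x, y) \<in> C" by (rule cong_trans[OF C cong_sym[OF C xy] yx])
    then show ?thesis using cl unfolding x y by (simp add: quot_def class_eq_iff)
  qed
  show "X \<sqsubseteq>\<^bsub>quot L C\<^esub> Z" if le: "X \<sqsubseteq>\<^bsub>quot L C\<^esub> Y" "Y \<sqsubseteq>\<^bsub>quot L C\<^esub> Z"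
  proof -
    have xy: "(x \<sqinter> y, x) \<in> C" and yz: "(y \<sqinter> z, y) \<in> C"
      using le cl unfolding x y z by (simp_all add: class_le_iff)
    have "(x \<sqinter> z, (x \<sqinter> y) \<sqinter> z) \<in> C"
      by (rule cong_meet[OF C cong_sym[OF C xy] cong_refl[OF C z(1)]])
    moreover have "(x \<sqinter> (y \<sqinter> z), x \<sqinter> y) \<in> C"
      by (rule cong_meet[OF C cong_refl[OF C x(1)] yz])
    moreover have "(x \<sqinter> y) \<sqinter> z = x \<sqinter> (y \<sqinter> z)" using cl by (rule meet_assoc)
    ultimately have "(x \<sqinter> z, x) \<in> C"
      using cong_trans[OF C cong_trans[OF C] xy] by metis
    then show ?thesis using cl unfolding x z by (simp add: class_le_iff)
  qed
  show "X \<sqsubseteq>\<^bsub>quot L C\<^esub> X" using cl cong_refl[OF C] unfolding x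
    by (simp add: class_le_iff meet_idem)
qed (auto simp: quot_def)

lemma class_mono: "a \<in> carrier L \<Longrightarrow> b \<in> carrier L \<Longrightarrow> a \<sqsubseteq> b \<Longrightarrow> C `` {a} \<sqsubseteq>\<^bsub>quot L C\<^esub> C `` {b}"
  using cong_refl[OF C] by (simp add: class_le_iff meet_absorb)

text \<open>
  Joins of classes are classes of joins. If \<open>u\<close> represents an upper bound, then \<open>u \<sqinter> a\<close> and \<open>a\<close> are
  related for all \<open>a \<in> A\<close>, and the join of these pairs is computed with the frame law.
\<close>

lemma quot_least:
  assumes A: "A \<subseteq> carrier L" "kset \<kappa> A"
  shows "least (quot L C) (C `` {\<Squnion>A}) (Upper (quot L C) ((\<lambda>a. C `` {a}) ` A))"
proof (rule least_UpperI)
  show "X \<sqsubseteq>\<^bsub>quot L C\<^esub> C `` {\<Squnion>A}" if "X \<in> (\<lambda>a. C `` {a}) ` A" for X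
    using that A ksup_upper ksup_closed by (auto intro!: class_mono)
  show "C `` {\<Squnion>A} \<sqsubseteq>\<^bsub>quot L C\<^esub> U" if U: "U \<in> Upper (quot L C) ((\<lambda>a. C `` {a}) ` A)" for U
  proof -
    have "U \<in> carrier (quot L C)" using U by (simp add: Upper_def)
    then obtain u where u: "u \<in> carrier L" "U = C `` {u}" by (auto simp: quot_carrier)
    have le: "C `` {a} \<sqsubseteq>\<^bsub>quot L C\<^esub> C `` {u}" if "a \<in> A" for a
      using U that A class_closed unfolding u(2) Upper_def by auto
    have "(u \<sqinter> a, a) \<in> C" if "a \<in> A" for a
      using le[OF that] class_le_iff[OF subsetD[OF A(1) that] u(1)] by (simp add: meet_comm[of L u])
    then have "(\<Squnion>((\<lambda>a. u \<sqinter> a) ` A), \<Squnion>((\<lambda>a. a) ` A)) \<in> C"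
      using A by (intro cong_ksup[OF C])
    moreover have "\<Squnion>((\<lambda>a. u \<sqinter> a) ` A) = \<Squnion>A \<sqinter> u"
      using meet_ksup_distrib[OF u(1) A] meet_comm by metis
    ultimately have "(\<Squnion>A \<sqinter> u, \<Squnion>A) \<in> C" by simp
    then show ?thesis using A u by (simp add: class_le_iff ksup_closed)
  qed
qed (use A ksup_closed class_closed in auto)

lemma quot_greatest:
  assumes ab: "a \<in> carrier L" "b \<in> carrier L"
  shows "greatest (quot L C) (C `` {a \<sqinter> b}) (Lower (quot L C) {C `` {a}, C `` {b}})"
proof (rule greatest_LowerI)
  show "C `` {a \<sqinter> b} \<sqsubseteq>\<^bsub>quot L C\<^esub> X" if "X \<in> {C `` {a}, C `` {b}}" for X
    using that ab meet_left meet_right by (auto intro!: class_mono)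
  show "U \<sqsubseteq>\<^bsub>quot L C\<^esub> C `` {a \<sqinter> b}" if U: "U \<in> Lower (quot L C) {C `` {a}, C `` {b}}" for U
  proof -
    have "U \<in> carrier (quot L C)" using U by (simp add: Lower_def)
    then obtain u where u: "u \<in> carrier L" "U = C `` {u}" by (auto simp: quot_carrier)
    have ua: "(u \<sqinter> a, u) \<in> C" and ub: "(u \<sqinter> b, u) \<in> C"
      using U ab u class_closed unfolding u(2) Lower_def by (auto simp: class_le_iff)
    have "(u \<sqinter> a \<sqinter> b, u \<sqinter> b) \<in> C" by (rule cong_meet[OF C ua cong_refl[OF C ab(2)]])
    from cong_trans[OF C this ub] have "(u \<sqinter> (a \<sqinter> b), u) \<in> C" using ab u by (simp add: meet_assoc)
    then show ?thesis using ab u by (simp add: class_le_iff)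
  qed
qed (use ab class_closed in auto)

lemma class_Sup:
  "A \<subseteq> carrier L \<Longrightarrow> kset \<kappa> A \<Longrightarrow> \<Squnion>\<^bsub>quot L C\<^esub>((\<lambda>a. C `` {a}) ` A) = C `` {\<Squnion>A}"
  by (intro partial_order.Sup_eqI quot_partial_order quot_least)

lemma class_meet:
  "a \<in> carrier L \<Longrightarrow> b \<in> carrier L \<Longrightarrow> C `` {a} \<sqinter>\<^bsub>quot L C\<^esub> C `` {b} = C `` {a \<sqinter> b}"
  unfolding meet_def[of "quot L C"]
  by (intro partial_order.Inf_eqI quot_partial_order quot_greatest)

lemma class_join:
  "a \<in> carrier L \<Longrightarrow> b \<in> carrier L \<Longrightarrow> C `` {a} \<squnion>\<^bsub>quot L C\<^esub> C `` {b} = C `` {a \<squnion> b}"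
  using class_Sup[of "{a, b}"] by (simp add: join_def kset_finite adm)

lemma quot_kframe: "kframe \<kappa> (quot L C)"
proof -
  interpret po: partial_order "quot L C" by (rule quot_partial_order)
  have Sup: "\<exists>s. least (quot L C) s (Upper (quot L C) F)"
    if "F \<subseteq> carrier (quot L C)" "kset \<kappa> F" for F
    using kset_lift[OF that[unfolded quot_carrier]] quot_least by metis
  show ?thesis
  proof unfold_locales
    show "\<exists>s. least (quot L C) s (Upper (quot L C) F)"
      if "F \<subseteq> carrier (quot L C)" "kset \<kappa> F" for F using Sup that .
    show "\<exists>s. least (quot L C) s (Upper (quot L C) {X, Y})"
      if "X \<in> carrier (quot L C)" "Y \<in> carrier (quot L C)" for X Y
      using that by (intro Sup) (simp_all add: kset_finite adm)
    show "\<exists>s. greatest (quot L C) s (Lower (quot L C) {X, Y})"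
      if "X \<in> carrier (quot L C)" "Y \<in> carrier (quot L C)" for X Y
      using that quot_greatest by (force simp: quot_carrier)
    show "\<exists>s. least (quot L C) s (carrier (quot L C))"
      by (rule exI[of _ "C `` {\<bottom>}"]) (auto simp: least_def quot_carrier intro!: class_mono)
    show "\<exists>s. greatest (quot L C) s (carrier (quot L C))"
      by (rule exI[of _ "C `` {\<top>}"]) (auto simp: greatest_def quot_carrier intro!: class_mono)
    show "X \<sqinter>\<^bsub>quot L C\<^esub> (Y \<squnion>\<^bsub>quot L C\<^esub> Z)
        = X \<sqinter>\<^bsub>quot L C\<^esub> Y \<squnion>\<^bsub>quot L C\<^esub> X \<sqinter>\<^bsub>quot L C\<^esub> Z"
      if "X \<in> carrier (quot L C)" "Y \<in> carrier (quot L C)" "Z \<in> carrier (quot L C)" for X Y Z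
      using that by (auto simp: quot_carrier class_join class_meet distrib)
    show "X \<sqinter>\<^bsub>quot L C\<^esub> \<Squnion>\<^bsub>quot L C\<^esub>F = \<Squnion>\<^bsub>quot L C\<^esub>((\<sqinter>\<^bsub>quot L C\<^esub>) X ` F)"
      if X: "X \<in> carrier (quot L C)" and F: "F \<subseteq> carrier (quot L C)" "kset \<kappa> F" for X F
    proof -
      obtain x where x: "x \<in> carrier L" "X = C `` {x}" using X by (auto simp: quot_carrier)
      obtain A where A: "A \<subseteq> carrier L" "kset \<kappa> A" "F = (\<lambda>a. C `` {a}) ` A"
        using kset_lift[OF F[unfolded quot_carrier]] by metis
      have "(\<sqinter>\<^bsub>quot L C\<^esub>) X ` F = (\<lambda>a. C `` {a}) ` ((\<sqinter>) x ` A)"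
        unfolding A(3) x(2) image_image using A x by (intro image_cong) (auto simp: class_meet)
      moreover have "(\<sqinter>) x ` A \<subseteq> carrier L" using A x by auto
      ultimately show ?thesis unfolding A(3) x(2) using A x
        by (simp add: class_Sup class_meet ksup_closed kset_image meet_ksup_distrib)
    qed
  qed
qed

lemma quot_admissible_kframe: "admissible_kframe \<kappa> (quot L C)"
  by (intro admissible_kframe.intro admissible_kframe_axioms.intro quot_kframe adm)

text \<open>
  Inverse and direct image of a relation along the projection of \<open>L\<close> onto \<open>quot L C\<close>.
\<close>

definition pull where
  "pull D = {(a, b) \<in> carrier L \<times> carrier L. (C `` {a}, C `` {b}) \<in> D}"

abbreviation push where
  "push R \<equiv> map_prod (\<lambda>a. C `` {a}) (\<lambda>a. C `` {a}) ` R"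

lemma congruence_pull:
  assumes D: "congruence \<kappa> (quot L C) D" shows "congruence \<kappa> L (pull D)"
proof (rule congruenceI)
  interpret Q: admissible_kframe \<kappa> "quot L C" by (rule quot_admissible_kframe)
  show "equiv (carrier L) (pull D)"
  proof (intro equivI refl_onI symI transI)
    fix x y z assume "(x, y) \<in> pull D" "(y, z) \<in> pull D"
    then show "(x, z) \<in> pull D" using Q.cong_trans[OF D] by (auto simp: pull_def)
  qed (use Q.cong_refl[OF D] Q.cong_sym[OF D] class_closed in \<open>auto simp: pull_def\<close>)
  show "(a \<sqinter> c, b \<sqinter> d) \<in> pull D" if "(a, b) \<in> pull D" "(c, d) \<in> pull D" for a b c d
    using that Q.cong_meet[OF D] by (auto simp: pull_def class_meet[symmetric])
  show "(\<Squnion>(fst ` S), \<Squnion>(snd ` S)) \<in> pull D" if S: "S \<subseteq> pull D" "kset \<kappa> S" for S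
  proof -
    have A: "fst ` S \<subseteq> carrier L" "snd ` S \<subseteq> carrier L"
      using S(1) by (auto simp: pull_def)
    note S' = kset_image[OF S(2), of fst] kset_image[OF S(2), of snd]
    have "(\<Squnion>\<^bsub>quot L C\<^esub>((\<lambda>p. C `` {fst p}) ` S), \<Squnion>\<^bsub>quot L C\<^esub>((\<lambda>p. C `` {snd p}) ` S)) \<in> D"
      using S by (intro Q.cong_ksup[OF D]) (auto simp: pull_def)
    then show ?thesis using A S' class_Sup[of "fst ` S"] class_Sup[of "snd ` S"]
      by (simp add: pull_def ksup_closed image_image)
  qed
qed

text \<open>
  The inclusion \<open>C \<subseteq> E\<close> is what makes the direct image transitive: pairs of \<open>E\<close> that meet in a common
  class only have \<open>C\<close>-related middle elements.
\<close>

lemma congruence_push: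
  assumes E: "congruence \<kappa> L E" "C \<subseteq> E" shows "congruence \<kappa> (quot L C) (push E)"
proof -
  interpret Q: admissible_kframe \<kappa> "quot L C" by (rule quot_admissible_kframe)
  have carr: "a \<in> carrier L \<and> b \<in> carrier L" if "(a, b) \<in> E" for a b
    using that cong_fst[OF E(1)] cong_snd[OF E(1)] by simp
  show ?thesis
  proof (rule Q.congruenceI)
    show "equiv (carrier (quot L C)) (push E)"
    proof (intro equivI refl_onI symI transI)
      show "push E \<subseteq> carrier (quot L C) \<times> carrier (quot L C)"
        using carr class_closed by auto
      show "(X, X) \<in> push E" if X: "X \<in> carrier (quot L C)" for X
      proof -
        obtain x where "x \<in> carrier L" "X = C `` {x}" using X by (auto simp: quot_carrier)
        then show ?thesis using cong_refl[OF E(1)] by (intro image_eqI[of _ _ "(x, x)"]) simp_all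
      qed
      show "(Y, X) \<in> push E" if XY: "(X, Y) \<in> push E" for X Y
      proof -
        obtain x y where "(x, y) \<in> E" "X = C `` {x}" "Y = C `` {y}" using XY by auto
        then show ?thesis using cong_sym[OF E(1)] by (intro image_eqI[of _ _ "(y, x)"]) simp_all
      qed
      fix X Y Z assume "(X, Y) \<in> push E" "(Y, Z) \<in> push E"
      then obtain a b b' c where *: "(a, b) \<in> E" "(b', c) \<in> E"
        "X = C `` {a}" "Y = C `` {b}" "Y = C `` {b'}" "Z = C `` {c}" by auto
      have "(b, b') \<in> C" using * carr class_eq_iff by metis
      then have "(b, b') \<in> E" using E(2) by auto
      then have "(a, c) \<in> E" using cong_trans[OF E(1)] * by metis
      then show "(X, Z) \<in> push E" using * by (intro image_eqI[of _ _ "(a, c)"]) simp_all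
    qed
    show "(W \<sqinter>\<^bsub>quot L C\<^esub> Y, X \<sqinter>\<^bsub>quot L C\<^esub> Z) \<in> push E"
      if WX: "(W, X) \<in> push E" and YZ: "(Y, Z) \<in> push E" for W X Y Z
    proof -
      obtain a b c d where *: "(a, b) \<in> E" "(c, d) \<in> E"
        "W = C `` {a}" "X = C `` {b}" "Y = C `` {c}" "Z = C `` {d}" using WX YZ by auto
      have "(a \<sqinter> c, b \<sqinter> d) \<in> E" using cong_meet[OF E(1)] * by simp
      then show ?thesis using * carr
        by (intro image_eqI[of _ _ "(a \<sqinter> c, b \<sqinter> d)"]) (simp_all add: class_meet)
    qed
    show "(\<Squnion>\<^bsub>quot L C\<^esub>(fst ` S), \<Squnion>\<^bsub>quot L C\<^esub>(snd ` S)) \<in> push E"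
      if S: "S \<subseteq> push E" "kset \<kappa> S" for S
    proof -
      obtain T where T: "T \<subseteq> E" "kset \<kappa> T" "S = push T" using kset_lift[OF S] by metis
      have A: "fst ` T \<subseteq> carrier L" "snd ` T \<subseteq> carrier L"
        using T(1) carr by (auto simp: image_subset_iff)
      have "fst ` S = (\<lambda>a. C `` {a}) ` fst ` T" "snd ` S = (\<lambda>a. C `` {a}) ` snd ` T"
        unfolding T(3) by (simp_all add: image_image)
      moreover have "(\<Squnion>(fst ` T), \<Squnion>(snd ` T)) \<in> E"
        using T by (intro cong_ksup[OF E(1)]) auto
      ultimately show ?thesis using A T(2)
        by (intro image_eqI[of _ _ "(\<Squnion>(fst ` T), \<Squnion>(snd ` T))"])
           (simp_all add: class_Sup kset_image)
    qed
  qed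
qed

text \<open>
  The correspondence theorem at the level of generators. The inclusion from left to right holds
  because the direct image of \<open>cgen \<kappa> L (R \<union> C)\<close> is a congruence above \<open>push R\<close>, and a congruence
  containing \<open>C\<close> is recovered from its direct image.
\<close>

lemma pull_cgen:
  assumes R: "R \<subseteq> carrier L \<times> carrier L"
  shows "pull (cgen \<kappa> (quot L C) (push R)) = cgen \<kappa> L (R \<union> C)"
proof
  interpret Q: admissible_kframe \<kappa> "quot L C" by (rule quot_admissible_kframe)
  have RC: "R \<union> C \<subseteq> carrier L \<times> carrier L" using R cong_subset[OF C] by simp
  have pR: "push R \<subseteq> carrier (quot L C) \<times> carrier (quot L C)" using R class_closed by auto
  note E = congruence_cgen[OF RC] and D = Q.congruence_cgen[OF pR]
  have CE: "C \<subseteq> cgen \<kappa> L (R \<union> C)" and RE: "R \<subseteq> cgen \<kappa> L (R \<union> C)"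
    using cgen_superset[of "R \<union> C"] by simp_all
  show "cgen \<kappa> L (R \<union> C) \<subseteq> pull (cgen \<kappa> (quot L C) (push R))"
  proof (rule cgen_least[OF congruence_pull[OF D]], rule Un_least)
    show "R \<subseteq> pull (cgen \<kappa> (quot L C) (push R))"
      using R Q.cgen_superset[of "push R"] by (force simp: pull_def)
    show "C \<subseteq> pull (cgen \<kappa> (quot L C) (push R))"
    proof (rule subrelI)
      fix a b assume ab: "(a, b) \<in> C"
      then have c: "a \<in> carrier L" "b \<in> carrier L" using cong_fst[OF C] cong_snd[OF C] by simp_all
      then have "C `` {a} = C `` {b}" using ab by (simp add: class_eq_iff)
      then show "(a, b) \<in> pull (cgen \<kappa> (quot L C) (push R))"
        using c Q.cong_refl[OF D class_closed] by (simp add: pull_def)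
    qed
  qed
  have D_sub: "cgen \<kappa> (quot L C) (push R) \<subseteq> push (cgen \<kappa> L (R \<union> C))"
    using RE by (intro Q.cgen_least congruence_push E CE image_mono)
  show "pull (cgen \<kappa> (quot L C) (push R)) \<subseteq> cgen \<kappa> L (R \<union> C)"
  proof (rule subrelI)
    fix a b assume ab: "(a, b) \<in> pull (cgen \<kappa> (quot L C) (push R))"
    then have c: "a \<in> carrier L" "b \<in> carrier L" by (simp_all add: pull_def)
    from ab have "(C `` {a}, C `` {b}) \<in> push (cgen \<kappa> L (R \<union> C))"
      using D_sub by (auto simp: pull_def)
    then obtain a' b' where *: "(a', b') \<in> cgen \<kappa> L (R \<union> C)" "C `` {a} = C `` {a'}" "C `` {b} = C `` {b'}"
      by auto
    have "(a, a') \<in> C" "(b', b) \<in> C"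
      using * c cong_fst[OF E *(1)] cong_snd[OF E *(1)] class_eq_iff by metis+
    then show "(a, b) \<in> cgen \<kappa> L (R \<union> C)"
      using cong_trans[OF E cong_trans[OF E subsetD[OF CE] *(1)] subsetD[OF CE]] by simp
  qed
qed

lemma pull_mono_iff:
  assumes "D \<subseteq> carrier (quot L C) \<times> carrier (quot L C)"
  shows "pull D \<subseteq> pull D' \<longleftrightarrow> D \<subseteq> D'"
proof
  assume le: "pull D \<subseteq> pull D'"
  show "D \<subseteq> D'"
  proof (rule subrelI)
    fix X Y assume XY: "(X, Y) \<in> D"
    then obtain x y where *: "x \<in> carrier L" "y \<in> carrier L" "X = C `` {x}" "Y = C `` {y}"
      using assms by (auto simp: quot_carrier)
    then have "(x, y) \<in> pull D" using XY by (simp add: pull_def)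
    then show "(X, Y) \<in> D'" using le * by (auto simp: pull_def)
  qed
qed (auto simp: pull_def)

end


section \<open>Homomorphisms and isomorphisms\<close>

lemma hom_meet:
  assumes "kframe_hom \<kappa> L M f" "a \<in> carrier L" "b \<in> carrier L"
  shows "f (a \<sqinter> b) = f a \<sqinter>\<^bsub>M\<^esub> f b"
proof -
  have "f (\<Sqinter>{a, b}) = \<Sqinter>\<^bsub>M\<^esub>(f ` {a, b})"
    using assms unfolding kframe_hom_def by (metis empty_subsetI finite.emptyI finite_insert insert_subset)
  then show ?thesis by (simp add: meet_def)
qed

lemma hom_Sup:
  assumes "kframe_hom \<kappa> L M f" "A \<subseteq> carrier L" "kset \<kappa> A"
  shows "f (\<Squnion>A) = \<Squnion>\<^bsub>M\<^esub>(f ` A)"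
  using assms unfolding kframe_hom_def by simp

lemma hom_join:
  assumes "kframe_hom \<kappa> L M f" "a \<in> carrier L" "b \<in> carrier L"
  shows "f (a \<squnion> b) = f a \<squnion>\<^bsub>M\<^esub> f b"
  using hom_Sup[OF assms(1), of "{a, b}"] assms(2,3) by (simp add: join_def kset_finite adm)

lemma complement_unique:
  assumes a: "a \<in> carrier L" and b: "b \<in> carrier L" "a \<sqinter> b = \<bottom>" "a \<squnion> b = \<top>"
    and c: "c \<in> carrier L" "a \<sqinter> c = \<bottom>" "a \<squnion> c = \<top>"
  shows "b = c"
proof -
  have *: "x \<sqsubseteq> y"
    if x: "x \<in> carrier L" "a \<sqinter> x = \<bottom>" and y: "y \<in> carrier L" "a \<squnion> y = \<top>" for x y
  proof -
    have "x = x \<sqinter> (a \<squnion> y)" using x y by (simp add: meet_absorb)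
    also have "\<dots> = x \<sqinter> a \<squnion> x \<sqinter> y" using x y(1) a by (simp only: distrib)
    also have "x \<sqinter> a = \<bottom>" using x meet_comm by metis
    also have "\<bottom> \<squnion> x \<sqinter> y = x \<sqinter> y" using x y by (simp add: join_absorb)
    finally show ?thesis using x y meet_right by metis
  qed
  show ?thesis using *[of b c] *[of c b] b c by (simp add: le_antisym)
qed

lemma nabla_complement:
  assumes c: "c \<in> carrier L"
  shows "nabla \<kappa> L c \<sqinter>\<^bsub>K\<^esub> cgen \<kappa> L {(c, \<top>)} = \<bottom>\<^bsub>K\<^esub>"
    and "nabla \<kappa> L c \<squnion>\<^bsub>K\<^esub> cgen \<kappa> L {(c, \<top>)} = \<top>\<^bsub>K\<^esub>"
proof -
  have ct: "{(c, \<top>)} \<subseteq> carrier L \<times> carrier L" using c by simp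
  have "cgen \<kappa> L {(\<bottom>, \<bottom>), (c, \<top>)} = cgen \<kappa> L {(c, \<top>)}"
  proof
    show "cgen \<kappa> L {(\<bottom>, \<bottom>), (c, \<top>)} \<subseteq> cgen \<kappa> L {(c, \<top>)}"
      using cong_refl[OF congruence_cgen[OF ct]] cgen_superset[of "{(c, \<top>)}"] ct
      by (intro cgen_mono_cong) simp_all
    show "cgen \<kappa> L {(c, \<top>)} \<subseteq> cgen \<kappa> L {(\<bottom>, \<bottom>), (c, \<top>)}"
      using cgen_superset[of "{(\<bottom>, \<bottom>), (c, \<top>)}"] ct by (intro cgen_mono_cong) simp_all
  qed
  with principal_complement[of \<bottom> c] c
  show "nabla \<kappa> L c \<sqinter>\<^bsub>K\<^esub> cgen \<kappa> L {(c, \<top>)} = \<bottom>\<^bsub>K\<^esub>"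
    "nabla \<kappa> L c \<squnion>\<^bsub>K\<^esub> cgen \<kappa> L {(c, \<top>)} = \<top>\<^bsub>K\<^esub>"
    by (simp_all add: nabla_def)
qed

lemma hom_bottom: "kframe_hom \<kappa> L M f \<Longrightarrow> f \<bottom> = \<Squnion>\<^bsub>M\<^esub>{}"
  using hom_Sup[of M f "{}"] by (simp add: sup_empty kset_finite adm)

lemma hom_top: "kframe_hom \<kappa> L M f \<Longrightarrow> f \<top> = \<Sqinter>\<^bsub>M\<^esub>{}"
  unfolding kframe_hom_def using inf_empty by (metis empty_subsetI finite.emptyI image_empty)

text \<open>
  The \<open>\<nabla>\<^sub>a\<close> need not generate under meets and joins alone, but homomorphisms preserve complements, which are
  unique in a distributive lattice. So the values at the complements of the \<open>\<nabla>\<^sub>c\<close> are determined too,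
  then those at principal congruences \<open>\<nabla>\<^sub>d \<sqinter> (\<nabla>\<^sub>c)'\<close> with \<open>c \<sqsubseteq> d\<close>, and finally those at their \<open>\<kappa>\<close>-joins.
\<close>

lemma kcong_hom_eqI:
  assumes f: "kframe_hom \<kappa> K M f" and g: "kframe_hom \<kappa> K M g"
    and eq: "\<And>a. a \<in> carrier L \<Longrightarrow> f (nabla \<kappa> L a) = g (nabla \<kappa> L a)"
    and A: "A \<in> carrier K"
  shows "f A = g A"
proof -
  interpret K: admissible_kframe \<kappa> K by (rule kcong_admissible_kframe)
  interpret M: admissible_kframe \<kappa> M
    using f by (intro admissible_kframe.intro admissible_kframe_axioms.intro adm)
       (simp add: kframe_hom_def)
  have closed: "h B \<in> carrier M" if "kframe_hom \<kappa> K M h" "B \<in> carrier K" for h B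
    using that by (auto simp: kframe_hom_def)
  have upper: "f (cgen \<kappa> L {(c, \<top>)}) = g (cgen \<kappa> L {(c, \<top>)})" if c: "c \<in> carrier L" for c
  proof (rule M.complement_unique)
    have D: "cgen \<kappa> L {(c, \<top>)} \<in> carrier K" using c by (simp add: kcong_principal)
    have cpl: "h (nabla \<kappa> L c) \<sqinter>\<^bsub>M\<^esub> h (cgen \<kappa> L {(c, \<top>)}) = \<bottom>\<^bsub>M\<^esub>"
      "h (nabla \<kappa> L c) \<squnion>\<^bsub>M\<^esub> h (cgen \<kappa> L {(c, \<top>)}) = \<top>\<^bsub>M\<^esub>"
      if h: "kframe_hom \<kappa> K M h" for h
      using K.hom_meet[OF h nabla_closed[OF c] D] K.hom_join[OF h nabla_closed[OF c] D]
        K.hom_bottom[OF h] K.hom_top[OF h] nabla_complement[OF c]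
      by (simp_all add: M.sup_empty M.inf_empty)
    show "f (nabla \<kappa> L c) \<in> carrier M" "f (cgen \<kappa> L {(c, \<top>)}) \<in> carrier M"
      "g (cgen \<kappa> L {(c, \<top>)}) \<in> carrier M"
      using f g D nabla_closed[OF c] closed by simp_all
    show "f (nabla \<kappa> L c) \<sqinter>\<^bsub>M\<^esub> f (cgen \<kappa> L {(c, \<top>)}) = \<bottom>\<^bsub>M\<^esub>"
      "f (nabla \<kappa> L c) \<squnion>\<^bsub>M\<^esub> f (cgen \<kappa> L {(c, \<top>)}) = \<top>\<^bsub>M\<^esub>"
      using cpl[OF f] by simp_all
    show "f (nabla \<kappa> L c) \<sqinter>\<^bsub>M\<^esub> g (cgen \<kappa> L {(c, \<top>)}) = \<bottom>\<^bsub>M\<^esub>"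
      "f (nabla \<kappa> L c) \<squnion>\<^bsub>M\<^esub> g (cgen \<kappa> L {(c, \<top>)}) = \<top>\<^bsub>M\<^esub>"
      using cpl[OF g] eq[OF c] by simp_all
  qed
  have principal: "f (cgen \<kappa> L {(c, d)}) = g (cgen \<kappa> L {(c, d)})"
    if c: "c \<in> carrier L" "d \<in> carrier L" "c \<sqsubseteq> d" for c d
  proof -
    have D: "cgen \<kappa> L {(c, \<top>)} \<in> carrier K" using c by (simp add: kcong_principal)
    have "cgen \<kappa> L {(c, d)} = nabla \<kappa> L d \<sqinter>\<^bsub>K\<^esub> cgen \<kappa> L {(c, \<top>)}"
      using c D by (simp add: kcong_meet nabla_closed nabla_Int_principal meet_absorb
          meet_comm[of L \<top>])
    then show ?thesis
      using K.hom_meet[OF f nabla_closed[OF c(2)] D] K.hom_meet[OF g nabla_closed[OF c(2)] D]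
        eq[OF c(2)] upper[OF c(1)] by simp
  qed
  obtain R where R: "R \<subseteq> carrier L \<times> carrier L" "kset \<kappa> R" "\<And>x y. (x, y) \<in> R \<Longrightarrow> x \<sqsubseteq> y"
    "A = cgen \<kappa> L R" using kcong_ordered_generators[OF A] by metis
  have F: "(\<lambda>p. cgen \<kappa> L {p}) ` R \<subseteq> carrier K" "kset \<kappa> ((\<lambda>p. cgen \<kappa> L {p}) ` R)"
    using R by (auto intro!: kset_image kcong_principal)
  have "f ` (\<lambda>p. cgen \<kappa> L {p}) ` R = g ` (\<lambda>p. cgen \<kappa> L {p}) ` R"
    unfolding image_image using R(1,3) principal by (intro image_cong) auto
  then show ?thesis
    unfolding R(4) kcong_Sup_principal[OF R(1,2)] using K.hom_Sup[OF f F] K.hom_Sup[OF g F] by simp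
qed

end

text \<open>All operations of a \<open>\<kappa>\<close>-frame are determined by its order.\<close>

lemma order_iso_kframe_iso:
  assumes adm: "admissible \<kappa>" and M: "kframe \<kappa> M" and N: "kframe \<kappa> N"
    and bij: "bij_betw f (carrier M) (carrier N)"
    and mono: "\<And>x y. x \<in> carrier M \<Longrightarrow> y \<in> carrier M \<Longrightarrow> x \<sqsubseteq>\<^bsub>M\<^esub> y \<longleftrightarrow> f x \<sqsubseteq>\<^bsub>N\<^esub> f y"
  shows "kframe_iso \<kappa> M N f"
proof -
  interpret M: admissible_kframe \<kappa> M
    using M adm by (intro admissible_kframe.intro admissible_kframe_axioms.intro)
  interpret N: admissible_kframe \<kappa> N
    using N adm by (intro admissible_kframe.intro admissible_kframe_axioms.intro)
  have cl: "f x \<in> carrier N" if "x \<in> carrier M" for x using bij that by (auto simp: bij_betw_def)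
  have onto: "\<exists>x\<in>carrier M. u = f x" if "u \<in> carrier N" for u
    using bij that by (auto simp: bij_betw_def)
  have "f (\<Sqinter>\<^bsub>M\<^esub>A) = \<Sqinter>\<^bsub>N\<^esub>(f ` A)" if A: "A \<subseteq> carrier M" "finite A" for A
  proof (rule N.inf_eqI[symmetric])
    show "f ` A \<subseteq> carrier N" "f (\<Sqinter>\<^bsub>M\<^esub>A) \<in> carrier N"
      using A cl M.finite_inf_closed by auto
    show "f (\<Sqinter>\<^bsub>M\<^esub>A) \<sqsubseteq>\<^bsub>N\<^esub> b" if b: "b \<in> f ` A" for b
    proof -
      obtain a where a: "a \<in> A" "b = f a" using b by auto
      then show ?thesis
        using A mono[OF M.finite_inf_closed[OF A(2,1)], of a] M.finite_inf_lower[OF A(2,1)] by auto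
    qed
    fix u assume u: "u \<in> carrier N" "\<And>b. b \<in> f ` A \<Longrightarrow> u \<sqsubseteq>\<^bsub>N\<^esub> b"
    obtain x where x: "x \<in> carrier M" "u = f x" using onto u(1) by auto
    then have "x \<sqsubseteq>\<^bsub>M\<^esub> a" if "a \<in> A" for a using u(2) mono A that by auto
    then show "u \<sqsubseteq>\<^bsub>N\<^esub> f (\<Sqinter>\<^bsub>M\<^esub>A)"
      using x A mono[of x "\<Sqinter>\<^bsub>M\<^esub>A"] M.finite_inf_closed M.le_finite_inf by simp
  qed
  moreover have "f (\<Squnion>\<^bsub>M\<^esub>A) = \<Squnion>\<^bsub>N\<^esub>(f ` A)" if A: "A \<subseteq> carrier M" "kset \<kappa> A" for A
  proof (rule N.sup_eqI[symmetric])
    show "f ` A \<subseteq> carrier N" "f (\<Squnion>\<^bsub>M\<^esub>A) \<in> carrier N"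
      using A cl M.ksup_closed by auto
    show "b \<sqsubseteq>\<^bsub>N\<^esub> f (\<Squnion>\<^bsub>M\<^esub>A)" if b: "b \<in> f ` A" for b
    proof -
      obtain a where a: "a \<in> A" "b = f a" using b by auto
      then show ?thesis
        using A mono[OF _ M.ksup_closed[OF A], of a] M.ksup_upper[OF A] by auto
    qed
    fix u assume u: "u \<in> carrier N" "\<And>b. b \<in> f ` A \<Longrightarrow> b \<sqsubseteq>\<^bsub>N\<^esub> u"
    obtain x where x: "x \<in> carrier M" "u = f x" using onto u(1) by auto
    then have "a \<sqsubseteq>\<^bsub>M\<^esub> x" if "a \<in> A" for a using u(2) mono A that by auto
    then show "f (\<Squnion>\<^bsub>M\<^esub>A) \<sqsubseteq>\<^bsub>N\<^esub> u"
      using x A mono[of "\<Squnion>\<^bsub>M\<^esub>A" x] M.ksup_closed M.ksup_le by simp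
  qed
  ultimately show ?thesis
    using M N bij cl by (simp add: kframe_iso_def kframe_hom_def)
qed

section \<open>The canonical isomorphism\<close>

context admissible_kframe
begin

text \<open>
  For \<open>(a, b) \<in> C\<close> the joins of \<open>\<nabla>\<^sub>a\<close> and \<open>\<nabla>\<^sub>b\<close> with \<open>C\<close> agree, which gives one inclusion by \<open>nabla_iff\<close>
  for \<open>K\<close>. For the other it suffices to relate \<open>\<bottom>\<close> to \<open>C\<close>, and, by taking joins, to the congruence of
  each ordered generator \<open>(c, d)\<close> of \<open>C\<close>. This pair arises from \<open>(\<nabla>\<^sub>c, \<nabla>\<^sub>d)\<close> by meeting both entries with
  the complement of \<open>\<nabla>\<^sub>c\<close>.
\<close>

lemma nabla_tilde_eq:
  assumes C: "C \<in> carrier K" shows "nabla_tilde \<kappa> L C = nabla \<kappa> K C"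
proof
  interpret K: admissible_kframe \<kappa> K by (rule kcong_admissible_kframe)
  note cC = kcong_congruence[OF C]
  let ?R = "{(nabla \<kappa> L a, nabla \<kappa> L b) | a b. (a, b) \<in> C}"
  have carr: "a \<in> carrier L \<and> b \<in> carrier L" if "(a, b) \<in> C" for a b
    using cong_fst[OF cC that] cong_snd[OF cC that] by simp
  have R: "?R \<subseteq> carrier K \<times> carrier K" using carr nabla_closed by blast
  note N = K.congruence_cgen[OF R]
  have le: "nabla \<kappa> L b \<squnion>\<^bsub>K\<^esub> C \<subseteq> nabla \<kappa> L a \<squnion>\<^bsub>K\<^esub> C" if ab: "(a, b) \<in> C" for a b
  proof -
    have mem: "nabla \<kappa> L a \<in> carrier K" "nabla \<kappa> L b \<in> carrier K"
      using carr[OF ab] nabla_closed by auto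
    then have J: "nabla \<kappa> L a \<squnion>\<^bsub>K\<^esub> C \<in> carrier K" using C by simp
    have sub: "nabla \<kappa> L a \<subseteq> nabla \<kappa> L a \<squnion>\<^bsub>K\<^esub> C" "C \<subseteq> nabla \<kappa> L a \<squnion>\<^bsub>K\<^esub> C"
      using K.join_left[OF mem(1) C] K.join_right[OF mem(1) C] by simp_all
    have "(\<bottom>, a) \<in> nabla \<kappa> L a" using cgen_superset[of "{(\<bottom>, a)}"] by (simp add: nabla_def)
    then have "(\<bottom>, b) \<in> nabla \<kappa> L a \<squnion>\<^bsub>K\<^esub> C"
      using cong_trans[OF kcong_congruence[OF J]] ab sub by (meson subsetD)
    then have "nabla \<kappa> L b \<subseteq> nabla \<kappa> L a \<squnion>\<^bsub>K\<^esub> C"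
      unfolding nabla_def[of _ _ b] by (intro cgen_least kcong_congruence J) simp
    then show ?thesis using K.join_le[OF _ _ mem(2) C J] sub by simp
  qed
  show "nabla_tilde \<kappa> L C \<subseteq> nabla \<kappa> K C"
    unfolding nabla_tilde_def
  proof (rule K.cgen_least[OF K.kcong_congruence[OF K.nabla_closed[OF C]]], rule subrelI)
    fix A B assume "(A, B) \<in> ?R"
    then obtain a b where ab: "(a, b) \<in> C" "A = nabla \<kappa> L a" "B = nabla \<kappa> L b" by blast
    then show "(A, B) \<in> nabla \<kappa> K C"
      using le[OF ab(1)] le[OF cong_sym[OF cC ab(1)]] carr[OF ab(1)] nabla_closed
      by (simp add: K.nabla_iff[OF C])
  qed
  obtain S where S: "S \<subseteq> carrier L \<times> carrier L" "kset \<kappa> S" "\<And>x y. (x, y) \<in> S \<Longrightarrow> x \<sqsubseteq> y"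
    "C = cgen \<kappa> L S" using kcong_ordered_generators[OF C] by metis
  have bot: "(\<bottom>\<^bsub>K\<^esub>, cgen \<kappa> L {p}) \<in> cgen \<kappa> K ?R" if p: "p \<in> S" for p
  proof -
    obtain c d where cd: "p = (c, d)" by (cases p)
    have c: "c \<in> carrier L" "d \<in> carrier L" "c \<sqsubseteq> d" using p S cd by auto
    have "(c, d) \<in> C" using p cd S(4) cgen_superset[of S] by auto
    then have "(nabla \<kappa> L c, nabla \<kappa> L d) \<in> ?R" by blast
    then have 1: "(nabla \<kappa> L c, nabla \<kappa> L d) \<in> cgen \<kappa> K ?R" by (rule subsetD[OF K.cgen_superset])
    have D: "cgen \<kappa> L {(c, \<top>)} \<in> carrier K" using c by (simp add: kcong_principal)
    have "nabla \<kappa> L d \<sqinter>\<^bsub>K\<^esub> cgen \<kappa> L {(c, \<top>)} = cgen \<kappa> L {p}"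
      using c D by (simp add: cd kcong_meet nabla_closed nabla_Int_principal meet_absorb
          meet_comm[of L \<top>])
    then show ?thesis
      using K.cong_meet[OF N 1 K.cong_refl[OF N D]] nabla_complement(1)[OF c(1)] by simp
  qed
  have "(\<Squnion>\<^bsub>K\<^esub>((\<lambda>p. \<bottom>\<^bsub>K\<^esub>) ` S), \<Squnion>\<^bsub>K\<^esub>((\<lambda>p. cgen \<kappa> L {p}) ` S)) \<in> cgen \<kappa> K ?R"
    using bot by (intro K.cong_ksup[OF N S(2)])
  moreover have "\<Squnion>\<^bsub>K\<^esub>((\<lambda>p. \<bottom>\<^bsub>K\<^esub>) ` S) = \<bottom>\<^bsub>K\<^esub>"
    by (intro K.sup_eqI K.bottom_lower) auto
  moreover have "\<Squnion>\<^bsub>K\<^esub>((\<lambda>p. cgen \<kappa> L {p}) ` S) = C"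
    using kcong_Sup_principal[OF S(1,2)] S(4) by simp
  ultimately have "{(\<bottom>\<^bsub>K\<^esub>, C)} \<subseteq> cgen \<kappa> K ?R" by simp
  from K.cgen_least[OF N this] show "nabla \<kappa> K C \<subseteq> nabla_tilde \<kappa> L C"
    by (simp add: nabla_tilde_def nabla_def)
qed

lemma canonical_iso_unique:
  assumes C: "congruence \<kappa> L C"
    and \<phi>: "canonical_iso \<kappa> L C \<phi>" and \<psi>: "canonical_iso \<kappa> L C \<psi>"
  shows "\<phi> = \<psi>"
proof (rule extensionalityI)
  interpret Q: admissible_kframe \<kappa> "quot L C" by (rule quot_admissible_kframe[OF C])
  show "\<phi> \<in> extensional (carrier Q.K)" "\<psi> \<in> extensional (carrier Q.K)"
    using \<phi> \<psi> by (simp_all add: canonical_iso_def)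
  show "\<phi> D = \<psi> D" if "D \<in> carrier Q.K" for D
  proof (rule Q.kcong_hom_eqI[OF _ _ _ that])
    show "kframe_hom \<kappa> Q.K (quot K (nabla_tilde \<kappa> L C)) \<phi>"
      "kframe_hom \<kappa> Q.K (quot K (nabla_tilde \<kappa> L C)) \<psi>"
      using \<phi> \<psi> by (simp_all add: canonical_iso_def kframe_iso_def)
    show "\<phi> (nabla \<kappa> (quot L C) X) = \<psi> (nabla \<kappa> (quot L C) X)"
      if X: "X \<in> carrier (quot L C)" for X
    proof -
      obtain a where "a \<in> carrier L" "X = C `` {a}" using X by (auto simp: quot_carrier[OF C])
      then show ?thesis using \<phi> \<psi> by (simp add: canonical_iso_def)
    qed
  qed
qed

text \<open>
  The isomorphism sends \<open>D\<close> to the class of its inverse image. Since inverse images contain \<open>C\<close>, joining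
  them with \<open>C\<close> changes nothing, and the order between their classes is plain inclusion.
\<close>

lemma canonical_iso_exists:
  assumes C: "C \<in> carrier K" shows "\<exists>\<phi>. canonical_iso \<kappa> L C \<phi>"
proof -
  note cC = kcong_congruence[OF C]
  interpret K: admissible_kframe \<kappa> K by (rule kcong_admissible_kframe)
  interpret Q: admissible_kframe \<kappa> "quot L C" by (rule quot_admissible_kframe[OF cC])
  define N where "N = nabla_tilde \<kappa> L C"
  have N: "congruence \<kappa> K N"
    unfolding N_def nabla_tilde_eq[OF C] by (rule K.kcong_congruence[OF K.nabla_closed[OF C]])
  have N_iff: "(A, B) \<in> N \<longleftrightarrow> A \<in> carrier K \<and> B \<in> carrier K \<and> A \<squnion>\<^bsub>K\<^esub> C = B \<squnion>\<^bsub>K\<^esub> C" for A B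
    unfolding N_def nabla_tilde_eq[OF C] by (rule K.nabla_iff[OF C])
  have pull_push: "pull C (cgen \<kappa> (quot L C) (push C R)) = cgen \<kappa> L R \<squnion>\<^bsub>K\<^esub> C"
    "cgen \<kappa> (quot L C) (push C R) \<in> carrier Q.K"
    if R: "R \<subseteq> carrier L \<times> carrier L" "kset \<kappa> R" for R
  proof -
    show "pull C (cgen \<kappa> (quot L C) (push C R)) = cgen \<kappa> L R \<squnion>\<^bsub>K\<^esub> C"
      using R C by (simp add: pull_cgen[OF cC] kcong_join_cgen)
    have "push C R \<subseteq> carrier (quot L C) \<times> carrier (quot L C)"
      using R(1) class_closed[OF cC] by auto
    then show "cgen \<kappa> (quot L C) (push C R) \<in> carrier Q.K"
      using R(2) by (intro Q.kcong_cgen kset_image)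
  qed
  have gen: "\<exists>R. R \<subseteq> carrier L \<times> carrier L \<and> kset \<kappa> R \<and> D = cgen \<kappa> (quot L C) (push C R)"
    if D: "D \<in> carrier Q.K" for D
  proof -
    obtain R' where R': "R' \<subseteq> carrier (quot L C) \<times> carrier (quot L C)" "kset \<kappa> R'"
      "D = cgen \<kappa> (quot L C) R'" using Q.kcong_ordered_generators[OF D] by metis
    have "R' \<subseteq> push C (carrier L \<times> carrier L)"
      using R'(1) by (simp add: quot_carrier[OF cC] map_prod_surj_on)
    from kset_lift[OF this R'(2)] show ?thesis using R'(3) by metis
  qed
  have pull_closed: "pull C D \<in> carrier K" "C \<subseteq> pull C D" if D: "D \<in> carrier Q.K" for D
  proof -
    obtain R where R: "R \<subseteq> carrier L \<times> carrier L" "kset \<kappa> R" "D = cgen \<kappa> (quot L C) (push C R)"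
      using gen[OF D] by blast
    have A: "cgen \<kappa> L R \<in> carrier K" using R by (simp add: kcong_cgen)
    show "pull C D \<in> carrier K" "C \<subseteq> pull C D"
      using K.join_closed[OF A C] K.join_right[OF A C] R pull_push by simp_all
  qed
  have class_join: "N `` {A \<squnion>\<^bsub>K\<^esub> C} = N `` {A}" if A: "A \<in> carrier K" for A
  proof -
    have "A \<squnion>\<^bsub>K\<^esub> C \<squnion>\<^bsub>K\<^esub> C = A \<squnion>\<^bsub>K\<^esub> C" using A C by (simp add: K.join_assoc K.join_idem)
    then have "(A \<squnion>\<^bsub>K\<^esub> C, A) \<in> N" using A C by (simp add: N_iff)
    then show ?thesis using A C by (simp add: K.class_eq_iff[OF N])
  qed
  define \<phi> where "\<phi> = restrict (\<lambda>D. N `` {pull C D}) (carrier Q.K)"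
  have le_iff: "D \<sqsubseteq>\<^bsub>Q.K\<^esub> D' \<longleftrightarrow> \<phi> D \<sqsubseteq>\<^bsub>quot K N\<^esub> \<phi> D'"
    if D: "D \<in> carrier Q.K" and D': "D' \<in> carrier Q.K" for D D'
  proof -
    note p = pull_closed[OF D] and p' = pull_closed[OF D']
    have "\<phi> D \<sqsubseteq>\<^bsub>quot K N\<^esub> \<phi> D' \<longleftrightarrow> (pull C D \<inter> pull C D', pull C D) \<in> N"
      using D D' p p' by (simp add: \<phi>_def K.class_le_iff[OF N] kcong_meet)
    also have "\<dots> \<longleftrightarrow> (pull C D \<inter> pull C D') \<squnion>\<^bsub>K\<^esub> C = pull C D \<squnion>\<^bsub>K\<^esub> C"
      using p p' by (simp add: N_iff kcong_Int)
    also have "(pull C D \<inter> pull C D') \<squnion>\<^bsub>K\<^esub> C = pull C D \<inter> pull C D'"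
      using p p' C kcong_Int K.join_absorb[OF C, of "pull C D \<inter> pull C D'"]
      by (simp add: join_comm[of K _ C])
    also have "pull C D \<squnion>\<^bsub>K\<^esub> C = pull C D"
      using p C K.join_absorb[OF C p(1)] by (simp add: join_comm[of K _ C])
    also have "pull C D \<inter> pull C D' = pull C D \<longleftrightarrow> pull C D \<subseteq> pull C D'" by blast
    also have "\<dots> \<longleftrightarrow> D \<subseteq> D'" using pull_mono_iff[OF cC] Q.kcong_bounds(2)[OF D] by simp
    finally show ?thesis by simp
  qed
  have "bij_betw \<phi> (carrier Q.K) (carrier (quot K N))"
    unfolding bij_betw_def
  proof
    show "inj_on \<phi> (carrier Q.K)"
    proof (rule inj_onI)
      fix D D' assume D: "D \<in> carrier Q.K" "D' \<in> carrier Q.K" "\<phi> D = \<phi> D'"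
      have "D \<subseteq> D'" "D' \<subseteq> D"
        using le_iff[OF D(1,2)] le_iff[OF D(1,1)] le_iff[OF D(2,1)] le_iff[OF D(2,2)] D(3) by simp_all
      then show "D = D'" by (rule equalityI)
    qed
    show "\<phi> ` carrier Q.K = carrier (quot K N)"
    proof
      show "\<phi> ` carrier Q.K \<subseteq> carrier (quot K N)"
        using pull_closed(1) K.class_closed[OF N] by (auto simp: \<phi>_def)
      show "carrier (quot K N) \<subseteq> \<phi> ` carrier Q.K"
      proof
        fix X assume "X \<in> carrier (quot K N)"
        then obtain A where A: "A \<in> carrier K" "X = N `` {A}" by (auto simp: K.quot_carrier[OF N])
        obtain R where R: "R \<subseteq> carrier L \<times> carrier L" "kset \<kappa> R" "A = cgen \<kappa> L R"
          using kcong_ordered_generators[OF A(1)] by metis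
        have "\<phi> (cgen \<kappa> (quot L C) (push C R)) = X"
          using pull_push[OF R(1,2)] class_join[OF A(1)] A R(3) by (simp add: \<phi>_def)
        then show "X \<in> \<phi> ` carrier Q.K" using pull_push(2)[OF R(1,2)] by (intro image_eqI) simp_all
      qed
    qed
  qed
  then have "kframe_iso \<kappa> Q.K (quot K N) \<phi>"
    using le_iff by (intro order_iso_kframe_iso adm Q.kcong_kframe K.quot_kframe[OF N])
  moreover have "\<phi> (nabla \<kappa> (quot L C) (C `` {a})) = N `` {nabla \<kappa> L a}" if a: "a \<in> carrier L" for a
  proof -
    have "\<bottom>\<^bsub>quot L C\<^esub> = C `` {\<bottom>}"
      using class_mono[OF cC] class_closed[OF cC]
      by (intro Q.bottom_eq[symmetric]) (auto simp: quot_carrier[OF cC])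
    then have eq: "nabla \<kappa> (quot L C) (C `` {a}) = cgen \<kappa> (quot L C) (push C {(\<bottom>, a)})"
      by (simp add: nabla_def)
    have R: "{(\<bottom>, a)} \<subseteq> carrier L \<times> carrier L" "kset \<kappa> {(\<bottom>, a)}"
      using a by (simp_all add: kset_finite adm)
    show ?thesis
      unfolding eq using pull_push[OF R] class_join[OF nabla_closed[OF a]]
      by (simp add: \<phi>_def nabla_def)
  qed
  ultimately have "canonical_iso \<kappa> L C \<phi>"
    by (simp add: canonical_iso_def N_def \<phi>_def)
  then show ?thesis by blast
qed

end

theorem mainTheorem5:
  fixes \<kappa> :: "'k rel option" and L :: "('a, 'm) gorder_scheme"
  assumes "admissible \<kappa>" and "kframe \<kappa> L"
  shows "kframe \<kappa> (kcong_lattice \<kappa> L) \<and>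
    zero_dimensional \<kappa> (kcong_lattice \<kappa> L) \<and>
    kframe_hom \<kappa> L (kcong_lattice \<kappa> L) (nabla \<kappa> L) \<and>
    inj_on (nabla \<kappa> L) (carrier L) \<and>
    (\<forall>C\<in>carrier (kcong_lattice \<kappa> L). \<exists>!\<phi>. canonical_iso \<kappa> L C \<phi>)"
proof -
  interpret admissible_kframe \<kappa> L
    using assms by (intro admissible_kframe.intro admissible_kframe_axioms.intro)
  show ?thesis
    using kcong_kframe kcong_zero_dimensional nabla_hom nabla_inj canonical_iso_exists
      canonical_iso_unique kcong_congruence by blast
qed

end
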